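(* Assume $K<\infty$. For every $(u,\gamma)\in BV(a,b)\times\mathcal M(a,b)$ with $\|u\|_{L^\infty}\le K$, $\gamma=D^su+g\mathcal L^1$, $g\in L^1(a,b)$, $u'-g\in L^2(a,b)$, one has $E''(u,\gamma)\le E(u,\gamma)$.
   Context: Fix $0<a<b<\infty$, $c_0>0$, $K\in(0,\infty)$; $f(t)=c_0\min\{t,1\}$; $I_\varepsilon(x)=(x-\varepsilon,x+\varepsilon)$; $\fint_Bh=\frac1{|B|}\int_Bh$. Flat norm $\|\mu\|_{\rm flat}=\sup\{\int\varphi\,d\mu:\varphi\in W^{1,\infty}_0(a,b),\|\varphi\|_{W^{1,\infty}}\le1\}$. For $u\in BV(a,b)$: $Du=u'\mathcal L^1+D^su$, $D^su=[u]\mathcal H^0\llcorner J_u+D^cu$. $E_\varepsilon(u,\gamma)=\int_a^b|u'-g|^2dx+\frac1\varepsilon\int_a^bf\big(\varepsilon\fint_{I_\varepsilon(x)\cap(a,b)}|g|dt\big)dx$ if $u\in W^{1,1}(a,b)$, $\|u\|_{L^\infty}\le K$, $\gamma=g\mathcal L^1$, $g\in L^1$, $u'-g\in L^2$; $+\infty$ otherwise. $E''(u,\gamma)=\inf\{\limsup_{\varepsilon\to0}E_\varepsilon(u_\varepsilon,\gamma_\varepsilon):u_\varepsilon\to u\text{ in }L^1,\ \|\gamma_\varepsilon-\gamma\|_{\rm flat}\to0\}$. $E(u,\gamma)=\int_a^b|u'-g|^2+c_0\int_a^b|g|+2\sum_{x\in J_u}f(\frac12|[u](x)|)+c_0|D^cu|(a,b)$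 if $u\in BV$, $\|u\|_\infty\le K$, $\gamma=D^su+g\mathcal L^1$, $g\in L^1$, $u'-g\in L^2$; $+\infty$ otherwise. *)

theory Defs
  imports "HOL-Analysis.Analysis"
begin

(* All objects live on the open interval (a,b).  Functions are real => real
   (representatives of a.e. classes); signed measures are set functions
   real set => real, only consulted on Borel subsets of (a,b). *)

definition f_cost :: "real \<Rightarrow> real \<Rightarrow> real" where
  "f_cost c0 t = c0 * min t 1"

definition sm_rep :: "real \<Rightarrow> real \<Rightarrow> (real set \<Rightarrow> real) \<Rightarrow> real measure \<Rightarrow> real measure \<Rightarrow> bool" where
  "sm_rep a b \<mu> P N \<longleftrightarrow>
     sets P = sets (restrict_space borel {a<..<b}) \<and> sets N = sets (restrict_space borel {a<..<b}) \<and>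
     finite_measure P \<and> finite_measure N \<and>
     (\<forall>A\<in>sets P. \<mu> A = measure P A - measure N A)"

definition signed_measure :: "real \<Rightarrow> real \<Rightarrow> (real set \<Rightarrow> real) \<Rightarrow> bool" where
  "signed_measure a b \<mu> \<longleftrightarrow> (\<exists>P N. sm_rep a b \<mu> P N)"

definition sm_eq :: "real \<Rightarrow> real \<Rightarrow> (real set \<Rightarrow> real) \<Rightarrow> (real set \<Rightarrow> real) \<Rightarrow> bool" where
  "sm_eq a b \<mu> \<nu> \<longleftrightarrow> (\<forall>A\<in>sets borel. A \<subseteq> {a<..<b} \<longrightarrow> \<mu> A = \<nu> A)"

definition sint :: "real \<Rightarrow> real \<Rightarrow> (real set \<Rightarrow> real) \<Rightarrow> (real \<Rightarrow> real) \<Rightarrow> real" where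
  "sint a b \<mu> \<phi> = (let PN = (SOME PN. sm_rep a b \<mu> (fst PN) (snd PN))
                    in integral\<^sup>L (fst PN) \<phi> - integral\<^sup>L (snd PN) \<phi>)"

definition total_variation :: "real \<Rightarrow> real \<Rightarrow> (real set \<Rightarrow> real) \<Rightarrow> real" where
  "total_variation a b \<mu> = Sup {(\<Sum>A\<in>\<P>. \<bar>\<mu> A\<bar>) | \<P>. finite \<P> \<and> disjoint \<P> \<and>
        (\<forall>A\<in>\<P>. A \<in> sets borel \<and> A \<subseteq> {a<..<b})}"

(* phi in W^{1,inf}_0(a,b) with ||phi||_inf + ||phi'||_inf <= 1 (Lipschitz representative) *)
definition flat_test :: "real \<Rightarrow> real \<Rightarrow> (real \<Rightarrow> real) \<Rightarrow> bool" where
  "flat_test a b \<phi> \<longleftrightarrow> \<phi> a = 0 \<and> \<phi> b = 0 \<and>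
     (\<exists>M L. M + L \<le> 1 \<and> (\<forall>x\<in>{a..b}. \<bar>\<phi> x\<bar> \<le> M) \<and>
            (\<forall>x\<in>{a..b}. \<forall>y\<in>{a..b}. \<bar>\<phi> x - \<phi> y\<bar> \<le> L * \<bar>x - y\<bar>))"

definition flat_norm :: "real \<Rightarrow> real \<Rightarrow> (real set \<Rightarrow> real) \<Rightarrow> real" where
  "flat_norm a b \<mu> = Sup {sint a b \<mu> \<phi> | \<phi>. flat_test a b \<phi>}"

definition cc1_test :: "real \<Rightarrow> real \<Rightarrow> (real \<Rightarrow> real) \<Rightarrow> bool" where
  "cc1_test a b \<phi> \<longleftrightarrow> (\<forall>x. \<phi> differentiable at x) \<and> continuous_on UNIV (deriv \<phi>) \<and>
     (\<exists>c d. a < c \<and> d < b \<and> (\<forall>x. x \<notin> {c..d} \<longrightarrow> \<phi> x = 0))"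

definition weak_deriv :: "real \<Rightarrow> real \<Rightarrow> (real \<Rightarrow> real) \<Rightarrow> (real \<Rightarrow> real) \<Rightarrow> bool" where
  "weak_deriv a b u v \<longleftrightarrow> set_integrable lborel {a<..<b} u \<and> set_integrable lborel {a<..<b} v \<and>
     (\<forall>\<phi>. cc1_test a b \<phi> \<longrightarrow>
        (LINT x:{a<..<b}|lborel. u x * deriv \<phi> x) = - (LINT x:{a<..<b}|lborel. v x * \<phi> x))"

definition BV_deriv :: "real \<Rightarrow> real \<Rightarrow> (real \<Rightarrow> real) \<Rightarrow> (real set \<Rightarrow> real) \<Rightarrow> bool" where
  "BV_deriv a b u \<mu> \<longleftrightarrow> set_integrable lborel {a<..<b} u \<and> signed_measure a b \<mu> \<and>
     (\<forall>\<phi>. cc1_test a b \<phi> \<longrightarrow>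
        (LINT x:{a<..<b}|lborel. u x * deriv \<phi> x) = - sint a b \<mu> \<phi>)"

definition jump_measure :: "real set \<Rightarrow> (real \<Rightarrow> real) \<Rightarrow> real set \<Rightarrow> real" where
  "jump_measure J jmp A = infsum jmp (J \<inter> A)"

definition ac_measure :: "(real \<Rightarrow> real) \<Rightarrow> real set \<Rightarrow> real" where
  "ac_measure g A = (LINT x:A|lborel. g x)"

definition cantor_type :: "real \<Rightarrow> real \<Rightarrow> (real set \<Rightarrow> real) \<Rightarrow> bool" where
  "cantor_type a b C \<longleftrightarrow> signed_measure a b C \<and>
     (\<exists>N\<in>sets borel. N \<subseteq> {a<..<b} \<and> emeasure lborel N = 0 \<and>
        (\<forall>A\<in>sets borel. A \<subseteq> {a<..<b} \<longrightarrow> C A = C (A \<inter> N))) \<and>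
     (\<forall>x\<in>{a<..<b}. C {x} = 0)"

definition BV_decomp :: "real \<Rightarrow> real \<Rightarrow> (real \<Rightarrow> real) \<Rightarrow> (real \<Rightarrow> real) \<Rightarrow> real set \<Rightarrow> (real \<Rightarrow> real)
     \<Rightarrow> (real set \<Rightarrow> real) \<Rightarrow> bool" where
  "BV_decomp a b u u' J jmp C \<longleftrightarrow>
     set_integrable lborel {a<..<b} u' \<and> J \<subseteq> {a<..<b} \<and> jmp summable_on J \<and> cantor_type a b C \<and>
     BV_deriv a b u (\<lambda>A. ac_measure u' A + jump_measure J jmp A + C A)"

definition ess_bound :: "real \<Rightarrow> real \<Rightarrow> real \<Rightarrow> (real \<Rightarrow> real) \<Rightarrow> bool" where
  "ess_bound a b K u \<longleftrightarrow> (AE x in lborel. x \<in> {a<..<b} \<longrightarrow> \<bar>u x\<bar> \<le> K)"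

definition L2_on :: "real \<Rightarrow> real \<Rightarrow> (real \<Rightarrow> real) \<Rightarrow> bool" where
  "L2_on a b h \<longleftrightarrow> h \<in> borel_measurable lborel \<and> set_integrable lborel {a<..<b} (\<lambda>x. (h x)\<^sup>2)"

definition avg_abs :: "real \<Rightarrow> real \<Rightarrow> real \<Rightarrow> (real \<Rightarrow> real) \<Rightarrow> real \<Rightarrow> real" where
  "avg_abs a b \<epsilon> g x =
     (LINT t:({x-\<epsilon><..<x+\<epsilon>} \<inter> {a<..<b})|lborel. \<bar>g t\<bar>) / measure lborel ({x-\<epsilon><..<x+\<epsilon>} \<inter> {a<..<b})"

(* E_eps(u,gamma); the infimum over admissible (u',g) is the value (they are unique a.e.),
   and it is +infinity when there is none *)
definition E_eps :: "real \<Rightarrow> real \<Rightarrow> real \<Rightarrow> real \<Rightarrow> real \<Rightarrow> (real \<Rightarrow> real) \<Rightarrow> (real set \<Rightarrow> real) \<Rightarrow> ereal" where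
  "E_eps a b c0 K \<epsilon> u \<gamma> =
     (INF p \<in> {(u', g). weak_deriv a b u u' \<and> ess_bound a b K u \<and> signed_measure a b \<gamma> \<and>
                       set_integrable lborel {a<..<b} g \<and> sm_eq a b \<gamma> (ac_measure g) \<and>
                       L2_on a b (\<lambda>x. u' x - g x)}.
        ereal ((LINT x:{a<..<b}|lborel. (fst p x - snd p x)\<^sup>2) +
               (1 / \<epsilon>) * (LINT x:{a<..<b}|lborel. f_cost c0 (\<epsilon> * avg_abs a b \<epsilon> (snd p) x))))"

definition E_gamma_sup :: "real \<Rightarrow> real \<Rightarrow> real \<Rightarrow> real \<Rightarrow> (real \<Rightarrow> real) \<Rightarrow> (real set \<Rightarrow> real) \<Rightarrow> ereal" where
  "E_gamma_sup a b c0 K u \<gamma> =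
     (INF p \<in> {(U, \<Gamma>). (\<forall>\<epsilon>>0. set_integrable lborel {a<..<b} (U \<epsilon>) \<and> signed_measure a b (\<Gamma> \<epsilon>)) \<and>
                       ((\<lambda>\<epsilon>. LINT x:{a<..<b}|lborel. \<bar>U \<epsilon> x - u x\<bar>) \<longlongrightarrow> 0) (at_right 0) \<and>
                       ((\<lambda>\<epsilon>. flat_norm a b (\<lambda>A. \<Gamma> \<epsilon> A - \<gamma> A)) \<longlongrightarrow> 0) (at_right 0)}.
        Limsup (at_right 0) (\<lambda>\<epsilon>. E_eps a b c0 K \<epsilon> (fst p \<epsilon>) (snd p \<epsilon>)))"

(* limit functional E(u,gamma); infimum over admissible decompositions (unique),
   +infinity when none exists *)
definition E_lim :: "real \<Rightarrow> real \<Rightarrow> real \<Rightarrow> real \<Rightarrow> (real \<Rightarrow> real) \<Rightarrow> (real set \<Rightarrow> real) \<Rightarrow> ereal" where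
  "E_lim a b c0 K u \<gamma> =
     (INF p \<in> {(u', J, jmp, C, g). BV_decomp a b u u' J jmp C \<and> ess_bound a b K u \<and>
                       signed_measure a b \<gamma> \<and> set_integrable lborel {a<..<b} g \<and>
                       sm_eq a b \<gamma> (\<lambda>A. jump_measure J jmp A + C A + ac_measure g A) \<and>
                       L2_on a b (\<lambda>x. u' x - g x)}.
        (case p of (u', J, jmp, C, g) \<Rightarrow>
          ereal ((LINT x:{a<..<b}|lborel. (u' x - g x)\<^sup>2) + c0 * (LINT x:{a<..<b}|lborel. \<bar>g x\<bar>) +
                 2 * infsum (\<lambda>x. f_cost c0 (\<bar>jmp x\<bar> / 2)) J + c0 * total_variation a b C)))"

end

theory Submission
  imports Defs
begin

text \<open>
  The recovery sequence is obtained by averaging \<open>u\<close> and \<open>\<gamma>\<close> over windows of length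
  at most \<open>\<epsilon>\<^sup>2\<close>, much shorter than the interaction range \<open>\<epsilon>\<close>. Averaging keeps the bound \<open>K\<close>, does not
  increase the \<open>L\<^sup>2\<close> norm of \<open>u' - g\<close> (Jensen), and moves \<open>\<gamma>\<close> by \<open>O(\<epsilon>\<^sup>2)\<close> in the flat norm.
  Only finitely many jumps are higher than \<open>2\<close>; each of them is seen by the nonlocal term on a set of
  length \<open>2 \<epsilon> + O(\<epsilon>\<^sup>2)\<close>, where \<open>f \<le> c0\<close> yields the cost \<open>2 c0\<close>. Everything else, that is \<open>g\<close>,
  the Cantor part and the small jumps, is paid linearly in the limit energy, and \<open>f(t) \<le> c0 t\<close>
  bounds its contribution by \<open>c0\<close> times the total variation of the remaining part of \<open>\<gamma>\<close>, which is
  computed with a Hahn set for \<open>\<gamma>\<close>.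
\<close>

section \<open>Fubini's theorem for bounded kernels\<close>

text \<open>Differentiating the window mean of u gives the density \<open>kap * \<mu> (W x)\<close>
  with \<mu> = Du, and \<mu> differs from \<gamma> only by the L^2 density h = u' - g. Hence
  \<open>kap * \<gamma> (W x)\<close> is taken as density of the approximating measure, and what
  remains of the derivative is exactly \<open>(1 - \<theta>) * avg h x\<close>; jump and Cantor
  parts are never smoothed separately. The rest is duality: the adjoint kernel has total mass one at
  each point, so it moves a 1-Lipschitz test function by at most the window length, and it transfers
  the weights of the nonlocal average back to the variation of \<gamma>. The exponent 2 is a choice:
  a high jump costs 2 c0 (1 + len / \<epsilon>), so any length o(\<epsilon>) leads to 2 c0. The
  linear cost is additive only through mutual singularity of the parts of \<gamma>; since an upper
  bound is asked, subadditivity takes its place: off the high jumps the variation is a difference of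
  two values of \<gamma>, and each part is bounded on these two sets.\<close>

lemma kernel_Fubini:
  fixes f :: "'a \<Rightarrow> real" and v :: "'b \<Rightarrow> real" and k :: "'a \<Rightarrow> 'b \<Rightarrow> real"
  assumes "sigma_finite_measure M" and "sigma_finite_measure N"
    and f: "integrable M f" and v: "integrable N v"
    and k [measurable]: "(\<lambda>(x, y). k x y) \<in> borel_measurable (M \<Otimes>\<^sub>M N)"
    and bnd: "\<And>x y. \<bar>k x y\<bar> \<le> c"
  shows kernel_Fubini_integrable1: "integrable M (\<lambda>x. f x * (\<integral>y. k x y * v y \<partial>N))"
    and kernel_Fubini_integrable2: "integrable N (\<lambda>y. v y * (\<integral>x. k x y * f x \<partial>M))"
    and kernel_Fubini_eq: "(\<integral>x. f x * (\<integral>y. k x y * v y \<partial>N) \<partial>M) = (\<integral>y. v y * (\<integral>x. k x y * f x \<partial>M) \<partial>N)"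
proof -
  interpret M: sigma_finite_measure M by fact
  interpret N: sigma_finite_measure N by fact
  interpret pair_sigma_finite M N ..
  note [measurable] = borel_measurable_integrable[OF f] borel_measurable_integrable[OF v]
  let ?H = "\<lambda>x y. f x * (k x y * v y)"
  have c: "0 \<le> c" using bnd[of undefined undefined] by linarith
  have int2: "integrable N (\<lambda>y. ?H x y)" if "x \<in> space M" for x
  proof (intro integrable_mult_right Bochner_Integration.integrable_bound[OF integrable_mult_right[OF v, of c]])
    show "(\<lambda>y. k x y * v y) \<in> borel_measurable N" using that by measurable
    show "AE y in N. norm (k x y * v y) \<le> norm (c * v y)"
      using bnd c by (auto simp: abs_mult intro!: mult_right_mono)
  qed
  have H: "integrable (M \<Otimes>\<^sub>M N) (\<lambda>(x, y). ?H x y)"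
  proof (rule Fubini_integrable)
    show "integrable M (\<lambda>x. \<integral>y. norm (case (x, y) of (x, y) \<Rightarrow> ?H x y) \<partial>N)"
    proof (rule Bochner_Integration.integrable_bound[OF integrable_mult_left[OF f, of "c * (\<integral>y. \<bar>v y\<bar> \<partial>N)"]])
      show "AE x in M. norm (\<integral>y. norm (case (x, y) of (x, y) \<Rightarrow> ?H x y) \<partial>N) \<le> norm (f x * (c * (\<integral>y. \<bar>v y\<bar> \<partial>N)))"
      proof (rule AE_I2)
        fix x assume x: "x \<in> space M"
        have "(\<integral>y. \<bar>?H x y\<bar> \<partial>N) \<le> (\<integral>y. \<bar>f x\<bar> * (c * \<bar>v y\<bar>) \<partial>N)"
          using v bnd
          by (intro integral_mono integrable_abs int2 x) (auto simp: abs_mult intro!: mult_left_mono mult_right_mono)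
        then show "norm (\<integral>y. norm (case (x, y) of (x, y) \<Rightarrow> ?H x y) \<partial>N) \<le> norm (f x * (c * (\<integral>y. \<bar>v y\<bar> \<partial>N)))"
          using c by (simp add: abs_mult)
      qed
    qed simp
    show "AE x in M. integrable N (\<lambda>y. case (x, y) of (x, y) \<Rightarrow> ?H x y)"
      using int2 by auto
  qed simp
  from integrable_fst[OF H] show "integrable M (\<lambda>x. f x * (\<integral>y. k x y * v y \<partial>N))" by simp
  have e: "v y * (\<integral>x. k x y * f x \<partial>M) = (\<integral>x. ?H x y \<partial>M)" for y
    by (subst integral_mult_right_zero[symmetric]) (simp add: ac_simps)
  from integrable_snd[OF H] show "integrable N (\<lambda>y. v y * (\<integral>x. k x y * f x \<partial>M))"
    by (simp add: e)
  from Fubini_integral[OF H] show "(\<integral>x. f x * (\<integral>y. k x y * v y \<partial>N) \<partial>M) = (\<integral>y. v y * (\<integral>x. k x y * f x \<partial>M) \<partial>N)"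
    by (simp add: e)
qed

section \<open>Sums of measures\<close>

text \<open>A signed measure is known only as a difference of finite measures. Two such differences
  are compared by moving the subtracted terms across, P + N' = P' + N, which needs the sum as a
  genuine measure. The sum P + N also serves as a majorant of the variation.\<close>

definition plus_measure :: "'a measure \<Rightarrow> 'a measure \<Rightarrow> 'a measure" where
  "plus_measure M N = measure_of (space M) (sets M) (\<lambda>A. emeasure M A + emeasure N A)"

lemma sets_plus_measure [simp, measurable_cong]: "sets (plus_measure M N) = sets M"
  and space_plus_measure [simp]: "space (plus_measure M N) = space M"
  by (auto simp: plus_measure_def)

lemma emeasure_plus_measure:
  assumes "sets N = sets M" "A \<in> sets M"
  shows "emeasure (plus_measure M N) A = emeasure M A + emeasure N A"
  unfolding plus_measure_def
proof (rule emeasure_measure_of_sigma)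
  show "countably_additive (sets M) (\<lambda>A. emeasure M A + emeasure N A)"
    using assms(1) by (auto simp: countably_additive_def suminf_emeasure suminf_add[symmetric])
qed (use assms in \<open>auto simp: positive_def sets.sigma_algebra_axioms\<close>)

lemma nn_integral_plus_measure:
  assumes s: "sets N = sets M" and f: "f \<in> borel_measurable M"
  shows "integral\<^sup>N (plus_measure M N) f = integral\<^sup>N M f + integral\<^sup>N N f"
proof -
  have sp: "space N = space M" using s by (rule sets_eq_imp_space_eq)
  from f show ?thesis
  proof (induction rule: borel_measurable_induct)
    case (cong f g)
    then show ?case
      by (metis (no_types, lifting) nn_integral_cong sp space_plus_measure)
  next
    case (set A)
    then show ?case using s by (simp add: emeasure_plus_measure)
  next
    case (mult u c)
    have "u \<in> borel_measurable (plus_measure M N)" "u \<in> borel_measurable N"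
      using mult s by (auto cong: measurable_cong_sets)
    with mult show ?case by (simp add: nn_integral_cmult distrib_left)
  next
    case (add u v)
    have "u \<in> borel_measurable (plus_measure M N)" "u \<in> borel_measurable N"
      "v \<in> borel_measurable (plus_measure M N)" "v \<in> borel_measurable N"
      using add s by (auto cong: measurable_cong_sets)
    with add show ?case by (simp add: nn_integral_add ac_simps)
  next
    case (seq U)
    have [measurable]: "U i \<in> borel_measurable (plus_measure M N)" "U i \<in> borel_measurable N" "U i \<in> borel_measurable M" for i
      using seq s by (auto cong: measurable_cong_sets)
    have "integral\<^sup>N (plus_measure M N) (\<lambda>x. SUP i. U i x) = (SUP i. integral\<^sup>N M (U i) + integral\<^sup>N N (U i))"
      using seq by (subst nn_integral_monotone_convergence_SUP) auto
    also have "\<dots> = (SUP i. integral\<^sup>N M (U i)) + (SUP i. integral\<^sup>N N (U i))"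
      using seq by (intro ennreal_SUP_add) (auto simp: incseq_def le_fun_def intro!: nn_integral_mono)
    also have "\<dots> = integral\<^sup>N M (\<lambda>x. SUP i. U i x) + integral\<^sup>N N (\<lambda>x. SUP i. U i x)"
      using seq by (subst (1 2) nn_integral_monotone_convergence_SUP) auto
    finally show ?case by (simp add: image_comp)
  qed
qed

lemma finite_measure_plus_measure:
  assumes "finite_measure M" "finite_measure N" "sets N = sets M"
  shows "finite_measure (plus_measure M N)"
proof (rule finite_measureI)
  interpret M: finite_measure M by fact
  interpret N: finite_measure N by fact
  have "space N = space M" using assms(3) by (rule sets_eq_imp_space_eq)
  then show "emeasure (plus_measure M N) (space (plus_measure M N)) \<noteq> \<infinity>"
    using assms(3) M.emeasure_finite[of "space M"] N.emeasure_finite[of "space M"]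
    by (simp add: emeasure_plus_measure)
qed

lemma measure_plus_measure:
  assumes "finite_measure M" "finite_measure N" "sets N = sets M" "A \<in> sets M"
  shows "measure (plus_measure M N) A = measure M A + measure N A"
proof -
  interpret M: finite_measure M by fact
  interpret N: finite_measure N by fact
  show ?thesis using assms(3,4)
    by (simp add: measure_def emeasure_plus_measure enn2real_plus M.emeasure_finite N.emeasure_finite less_top[symmetric])
qed

lemma integral_plus_measure:
  fixes f :: "'a \<Rightarrow> real"
  assumes s: "sets N = sets M" and f: "integrable M f" "integrable N f"
  shows "integral\<^sup>L (plus_measure M N) f = integral\<^sup>L M f + integral\<^sup>L N f"
proof -
  note [measurable] = borel_measurable_integrable[OF f(1)]
  have fin: "integral\<^sup>N M (\<lambda>x. ennreal (f x)) < top" "integral\<^sup>N M (\<lambda>x. ennreal (- f x)) < top"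
    "integral\<^sup>N N (\<lambda>x. ennreal (f x)) < top" "integral\<^sup>N N (\<lambda>x. ennreal (- f x)) < top"
    using f by (auto simp: real_integrable_def less_top)
  have "integrable (plus_measure M N) f"
    unfolding real_integrable_def using fin
    by (auto simp: nn_integral_plus_measure[OF s] less_top)
  with f fin show ?thesis
    by (simp add: real_lebesgue_integral_def nn_integral_plus_measure[OF s] enn2real_plus)
qed

section \<open>Signed measures\<close>

lemma sets_restrict_Ioo_iff:
  fixes a b :: real
  shows "A \<in> sets (restrict_space borel {a<..<b}) \<longleftrightarrow> A \<in> sets borel \<and> A \<subseteq> {a<..<b}"
  by (auto simp: sets_restrict_space_iff)

lemma sm_repD:
  assumes "sm_rep a b \<mu> P N"
  shows "sets P = sets (restrict_space borel {a<..<b})" "sets N = sets (restrict_space borel {a<..<b})"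
    "sets N = sets P" "space P = {a<..<b}" "space N = {a<..<b}"
    "finite_measure P" "finite_measure N"
    "\<And>A. A \<in> sets borel \<Longrightarrow> A \<subseteq> {a<..<b} \<Longrightarrow> \<mu> A = measure P A - measure N A"
proof -
  show s: "sets P = sets (restrict_space borel {a<..<b})" "sets N = sets (restrict_space borel {a<..<b})"
    "sets N = sets P" "finite_measure P" "finite_measure N"
    using assms by (auto simp: sm_rep_def)
  show "space P = {a<..<b}" "space N = {a<..<b}"
    using s(1,2)[THEN sets_eq_imp_space_eq] by (auto simp: space_restrict_space)
  show "\<And>A. A \<in> sets borel \<Longrightarrow> A \<subseteq> {a<..<b} \<Longrightarrow> \<mu> A = measure P A - measure N A"
    using assms by (auto simp: sm_rep_def sets_restrict_Ioo_iff)
qed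

lemma integrable_finite_measure_bounded:
  fixes \<phi> :: "real \<Rightarrow> real"
  assumes "finite_measure P" "sets P = sets (restrict_space borel {a<..<b})"
    and "\<phi> \<in> borel_measurable (restrict_space borel {a<..<b})"
    and "\<And>x. x \<in> {a<..<b} \<Longrightarrow> \<bar>\<phi> x\<bar> \<le> c"
  shows "integrable P \<phi>"
proof -
  interpret finite_measure P by fact
  have sp: "space P = {a<..<b}"
    using assms(2)[THEN sets_eq_imp_space_eq] by (auto simp: space_restrict_space)
  show ?thesis
  proof (rule integrable_const_bound[where B = c])
    show "\<phi> \<in> borel_measurable P"
      unfolding measurable_cong_sets[OF assms(2) refl] by fact
  qed (use assms(4) sp in auto)
qed

text \<open>\<open>sint\<close> evaluates a pair picked by \<open>SOME\<close>, so no concrete pair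
  can be inserted by unfolding. Two pairs with the same difference satisfy P + N' = P' + N as
  measures; integrating a bounded function over both sides shows that the choice does not
  matter.\<close>

lemma sint_eq:
  assumes rep: "sm_rep a b \<mu> P N"
    and m: "\<phi> \<in> borel_measurable (restrict_space borel {a<..<b})"
    and bnd: "\<And>x. x \<in> {a<..<b} \<Longrightarrow> \<bar>\<phi> x\<bar> \<le> c"
  shows "sint a b \<mu> \<phi> = integral\<^sup>L P \<phi> - integral\<^sup>L N \<phi>"
proof -
  define PN where "PN = (SOME PN. sm_rep a b \<mu> (fst PN) (snd PN))"
  define P' N' where "P' = fst PN" and "N' = snd PN"
  have "sm_rep a b \<mu> (fst PN) (snd PN)"
    unfolding PN_def using rep someI[of "\<lambda>PN. sm_rep a b \<mu> (fst PN) (snd PN)" "(P, N)"] by simp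
  then have rep': "sm_rep a b \<mu> P' N'" by (simp add: P'_def N'_def)
  note r = sm_repD[OF rep] and r' = sm_repD[OF rep']
  have sr: "sets N' = sets P" "sets N = sets P'" using r(1,2) r'(1,2) by simp_all
  have i: "integrable M \<phi>" if "finite_measure M" "sets M = sets (restrict_space borel {a<..<b})" for M
    using that by (rule integrable_finite_measure_bounded[OF _ _ m]) (rule bnd)
  have "plus_measure P N' = plus_measure P' N"
  proof (rule measure_eqI)
    fix A assume "A \<in> sets (plus_measure P N')"
    then have A: "A \<in> sets P" "A \<in> sets P'" "A \<in> sets N" "A \<in> sets N'" "A \<in> sets borel" "A \<subseteq> {a<..<b}"
      using r(1,2) r'(1,2) by (simp_all add: sets_restrict_Ioo_iff)
    interpret l: finite_measure "plus_measure P N'"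
      by (intro finite_measure_plus_measure r r' sr)
    interpret r: finite_measure "plus_measure P' N"
      by (intro finite_measure_plus_measure r r' sr)
    have "measure (plus_measure P N') A = measure (plus_measure P' N) A"
      using r(8)[OF A(5,6)] r'(8)[OF A(5,6)]
      by (simp add: measure_plus_measure A sr r(6,7) r'(6,7))
    then show "emeasure (plus_measure P N') A = emeasure (plus_measure P' N) A"
      by (simp add: l.emeasure_eq_measure r.emeasure_eq_measure)
  qed (use r(1) r'(1) in simp)
  then have "integral\<^sup>L (plus_measure P N') \<phi> = integral\<^sup>L (plus_measure P' N) \<phi>" by simp
  then have "integral\<^sup>L P \<phi> + integral\<^sup>L N' \<phi> = integral\<^sup>L P' \<phi> + integral\<^sup>L N \<phi>"
    by (simp add: integral_plus_measure sr i r(1,2,6,7) r'(1,2,6,7))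
  then show ?thesis
    unfolding sint_def PN_def[symmetric] by (simp add: P'_def N'_def)
qed

lemma sm_rep_diff:
  assumes "sm_rep a b \<mu> P N" "sm_rep a b \<nu> P' N'"
  shows "sm_rep a b (\<lambda>A. \<mu> A - \<nu> A) (plus_measure P N') (plus_measure N P')"
proof -
  note r = sm_repD[OF assms(1)] and r' = sm_repD[OF assms(2)]
  have sr: "sets N' = sets P" "sets P' = sets N" "sets N = sets P" using r(1,2) r'(1,2) by simp_all
  have "\<mu> A - \<nu> A = measure (plus_measure P N') A - measure (plus_measure N P') A" if "A \<in> sets P" for A
  proof -
    have A: "A \<in> sets borel" "A \<subseteq> {a<..<b}" using that r(1) by (auto simp: sets_restrict_Ioo_iff)
    show ?thesis
      using r(8)[OF A] r'(8)[OF A] by (simp add: measure_plus_measure that sr r(6,7) r'(6,7))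
  qed
  then show ?thesis
    unfolding sm_rep_def by (simp add: r(1,2) finite_measure_plus_measure r(6,7) r'(6,7) r'(1,2))
qed

lemma sint_diff:
  assumes "signed_measure a b \<mu>" "signed_measure a b \<nu>"
    and m: "\<phi> \<in> borel_measurable (restrict_space borel {a<..<b})"
    and bnd: "\<And>x. x \<in> {a<..<b} \<Longrightarrow> \<bar>\<phi> x\<bar> \<le> c"
  shows "sint a b (\<lambda>A. \<mu> A - \<nu> A) \<phi> = sint a b \<mu> \<phi> - sint a b \<nu> \<phi>"
proof -
  obtain P N P' N' where rep: "sm_rep a b \<mu> P N" "sm_rep a b \<nu> P' N'"
    using assms by (auto simp: signed_measure_def)
  note r = sm_repD[OF rep(1)] and r' = sm_repD[OF rep(2)]
  have i: "integrable M \<phi>" if "finite_measure M" "sets M = sets (restrict_space borel {a<..<b})" for M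
    using that by (rule integrable_finite_measure_bounded[OF _ _ m]) (rule bnd)
  have e: "sint a b \<kappa> \<phi> = integral\<^sup>L Q \<phi> - integral\<^sup>L R \<phi>" if "sm_rep a b \<kappa> Q R" for \<kappa> Q R
    by (rule sint_eq[OF that m]) (rule bnd)
  show ?thesis
    unfolding e[OF rep(1)] e[OF rep(2)] e[OF sm_rep_diff[OF rep]]
    by (simp add: integral_plus_measure i r(1,2,6,7) r'(1,2,6,7))
qed

lemma sint_zero:
  assumes "signed_measure a b \<mu>"
  shows "sint a b \<mu> (\<lambda>_. 0) = 0"
  using assms sint_eq[where \<phi> = "\<lambda>_. 0" and c = 0] by (auto simp: signed_measure_def)

text \<open>\<open>ennreal\<close> sends negative reals to 0, so the two densities are the positive
  and the negative part of g, although no maximum is written.\<close>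

lemma sm_rep_ac_measure:
  assumes g: "set_integrable lborel {a<..<b} g"
  defines "P \<equiv> restrict_space (density lborel (\<lambda>x. ennreal (indicator {a<..<b} x * g x))) {a<..<b}"
    and "N \<equiv> restrict_space (density lborel (\<lambda>x. ennreal (- indicator {a<..<b} x * g x))) {a<..<b}"
  shows "sm_rep a b (ac_measure g) P N"
proof -
  let ?g = "\<lambda>x. indicator {a<..<b} x * g x"
  have gi: "integrable lborel ?g" using g by (simp add: set_integrable_def)
  note [measurable] = borel_measurable_integrable[OF gi]
  have fin: "integral\<^sup>N lborel (\<lambda>x. ennreal (?g x)) < top" "integral\<^sup>N lborel (\<lambda>x. ennreal (- ?g x)) < top"
    using gi by (auto simp: real_integrable_def less_top)
  have dens: "measure (restrict_space (density lborel (\<lambda>x. ennreal (w x))) {a<..<b}) A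
      = enn2real (\<integral>\<^sup>+ x. ennreal (indicator A x * w x) \<partial>lborel)"
    if "A \<in> sets borel" "A \<subseteq> {a<..<b}" and [measurable]: "w \<in> borel_measurable borel"
    for w :: "real \<Rightarrow> real" and A
  proof -
    have "emeasure (restrict_space (density lborel (\<lambda>x. ennreal (w x))) {a<..<b}) A
      = (\<integral>\<^sup>+ x. ennreal (w x) * indicator A x \<partial>lborel)"
      using that(1,2) by (subst emeasure_restrict_space) (simp_all add: emeasure_density)
    also have "\<dots> = (\<integral>\<^sup>+ x. ennreal (indicator A x * w x) \<partial>lborel)"
      by (intro nn_integral_cong) (auto simp: indicator_def)
    finally show ?thesis by (simp add: measure_def)
  qed
  have finm: "finite_measure (restrict_space (density lborel (\<lambda>x. ennreal (w x))) {a<..<b})"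
    if [measurable]: "w \<in> borel_measurable borel" and "integral\<^sup>N lborel (\<lambda>x. ennreal (w x)) < top" for w :: "real \<Rightarrow> real"
  proof (rule finite_measureI)
    have "(\<integral>\<^sup>+ x. ennreal (w x) * indicator {a<..<b} x \<partial>lborel) \<le> integral\<^sup>N lborel (\<lambda>x. ennreal (w x))"
      by (intro nn_integral_mono) (auto simp: indicator_def)
    also have "\<dots> < top" by fact
    finally show "emeasure (restrict_space (density lborel (\<lambda>x. ennreal (w x))) {a<..<b})
        (space (restrict_space (density lborel (\<lambda>x. ennreal (w x))) {a<..<b})) \<noteq> \<infinity>"
      by (auto simp: emeasure_restrict_space space_restrict_space emeasure_density)
  qed
  have "ac_measure g A = measure P A - measure N A" if A: "A \<in> sets P" for A
  proof -
    have A': "A \<in> sets borel" "A \<subseteq> {a<..<b}"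
      using A by (auto simp: P_def sets_restrict_space_iff)
    have "integrable lborel (\<lambda>x. indicator A x * ?g x)"
      using integrable_mult_indicator[OF _ gi, of A] A' by simp
    then have "(\<integral>x. indicator A x * ?g x \<partial>lborel) = measure P A - measure N A"
      unfolding P_def N_def using A'
      by (subst (1 2) dens) (auto simp: real_lebesgue_integral_def)
    moreover have "ac_measure g A = (\<integral>x. indicator A x * ?g x \<partial>lborel)"
      unfolding ac_measure_def set_lebesgue_integral_def
      using A' by (intro Bochner_Integration.integral_cong) (auto simp: indicator_def)
    ultimately show ?thesis by simp
  qed
  moreover have "finite_measure P" "finite_measure N"
    unfolding P_def N_def using fin by (auto intro!: finm)
  ultimately show ?thesis
    unfolding sm_rep_def by (auto simp: P_def N_def sets_restrict_space)
qed

lemma signed_measure_ac_measure: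
  "set_integrable lborel {a<..<b} g \<Longrightarrow> signed_measure a b (ac_measure g)"
  using sm_rep_ac_measure unfolding signed_measure_def by blast

lemma sint_ac_measure:
  assumes g: "set_integrable lborel {a<..<b} g"
    and m: "\<phi> \<in> borel_measurable (restrict_space borel {a<..<b})"
    and bnd: "\<And>x. x \<in> {a<..<b} \<Longrightarrow> \<bar>\<phi> x\<bar> \<le> c"
  shows "sint a b (ac_measure g) \<phi> = (LINT x:{a<..<b}|lborel. \<phi> x * g x)"
proof -
  let ?O = "{a<..<b}"
  let ?g = "\<lambda>x. indicator ?O x * g x" and ?p = "\<lambda>x. indicator ?O x * \<phi> x"
  have gi: "integrable lborel ?g" using g by (simp add: set_integrable_def)
  note [measurable] = borel_measurable_integrable[OF gi]
  have [measurable]: "?p \<in> borel_measurable borel"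
    using m by (subst (asm) borel_measurable_restrict_space_iff) auto
  \<comment> \<open>The \<open>max 0\<close> makes visible the truncation hidden in
    \<open>ennreal\<close>, so that the density becomes a real factor under the Bochner
    integral.\<close>
  have pos: "(\<integral>x. \<phi> x \<partial>restrict_space (density lborel (\<lambda>x. ennreal (w x))) ?O) = (\<integral>x. max 0 (w x) * ?p x \<partial>lborel)"
    if [measurable]: "w \<in> borel_measurable borel" for w
  proof -
    have "(\<integral>x. \<phi> x \<partial>restrict_space (density lborel (\<lambda>x. ennreal (w x))) ?O)
        = (\<integral>x. ?p x \<partial>density lborel (\<lambda>x. ennreal (max 0 (w x))))"
      by (subst integral_restrict_space) (auto simp: ennreal_max_0)
    also have "\<dots> = (\<integral>x. max 0 (w x) * ?p x \<partial>lborel)"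
      by (subst integral_density) auto
    finally show ?thesis .
  qed
  have i: "integrable lborel (\<lambda>x. w x * ?p x)" if "integrable lborel w" for w :: "real \<Rightarrow> real"
  proof (rule Bochner_Integration.integrable_bound[OF integrable_mult_right[OF that, of c]])
    note [measurable] = borel_measurable_integrable[OF that]
    show "(\<lambda>x. w x * ?p x) \<in> borel_measurable lborel" by measurable
    show "AE x in lborel. norm (w x * ?p x) \<le> norm (c * w x)"
    proof (rule AE_I2)
      fix x show "norm (w x * ?p x) \<le> norm (c * w x)"
        using bnd[of x] by (cases "x \<in> ?O") (auto simp: abs_mult mult.commute[of "\<bar>w x\<bar>"] intro!: mult_right_mono)
    qed
  qed
  have "sint a b (ac_measure g) \<phi> = (\<integral>x. max 0 (?g x) * ?p x \<partial>lborel) - (\<integral>x. max 0 (- ?g x) * ?p x \<partial>lborel)"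
    by (subst sint_eq[OF sm_rep_ac_measure[OF g] m]) (rule bnd, assumption, simp add: pos)
  also have "\<dots> = (\<integral>x. max 0 (?g x) * ?p x - max 0 (- ?g x) * ?p x \<partial>lborel)"
    using gi by (subst Bochner_Integration.integral_diff) (auto intro!: i)
  also have "\<dots> = (LINT x:?O|lborel. \<phi> x * g x)"
    unfolding set_lebesgue_integral_def
    by (intro Bochner_Integration.integral_cong) (auto simp: indicator_def max_def)
  finally show ?thesis .
qed

text \<open>In an arbitrary representation P and N may share mass, and then P + N overestimates the
  variation; a Hahn set Y removes the common mass. The variation is expressed through two values of
  \<mu> itself, so that a decomposition of \<mu> into parts can later be inserted.\<close>

lemma Jordan_decomposition:
  assumes "signed_measure a b \<mu>"
  obtains P N Y where "sm_rep a b \<mu> P N" "Y \<in> sets borel" "Y \<subseteq> {a<..<b}"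
    "\<And>A. A \<in> sets borel \<Longrightarrow> A \<subseteq> {a<..<b} \<Longrightarrow> measure P A + measure N A = \<mu> (A \<inter> Y) - \<mu> (A - Y)"
proof -
  obtain P0 N0 where rep: "sm_rep a b \<mu> P0 N0" using assms by (auto simp: signed_measure_def)
  note r = sm_repD[OF rep]
  interpret P0: finite_measure P0 by (fact r)
  interpret N0: finite_measure N0 by (fact r)
  obtain Y where Y: "Y \<in> sets P0" "\<And>X. X \<in> sets P0 \<Longrightarrow> X \<subseteq> Y \<Longrightarrow> emeasure N0 X \<le> emeasure P0 X"
    "\<And>X. X \<in> sets P0 \<Longrightarrow> X \<inter> Y = {} \<Longrightarrow> emeasure P0 X \<le> emeasure N0 X"
    using finite_unsigned_Hahn_decomposition[OF r(6,7,3)] by auto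
  define Z where "Z = {a<..<b} - Y"
  have YZ: "Y \<in> sets P0" "Y \<in> sets N0" "Z \<in> sets P0" "Z \<in> sets N0"
    using Y(1) sets.compl_sets[OF Y(1)] r(3,4) by (simp_all add: Z_def)
  have disjnt: "Z \<inter> A \<inter> Y = {}" for A by (auto simp: Z_def)
  \<comment> \<open>Subtraction of measures is meaningful only under domination. Restricting both
    measures to Y provides it, since \<open>P0\<close> dominates \<open>N0\<close> there; on the
    complement Z the roles are exchanged.\<close>
  define P where "P = diff_measure (density P0 (indicator Y)) (density N0 (indicator Y))"
  define N where "N = diff_measure (density N0 (indicator Z)) (density P0 (indicator Z))"
  have sets: "sets P = sets P0" "sets N = sets P0" by (simp_all add: P_def N_def r(3))
  have eP: "emeasure P A = emeasure P0 (Y \<inter> A) - emeasure N0 (Y \<inter> A)" if A: "A \<in> sets P0" for A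
  proof -
    have "emeasure P A = emeasure (density P0 (indicator Y)) A - emeasure (density N0 (indicator Y)) A"
      unfolding P_def
    proof (rule emeasure_diff_measure)
      fix B assume "B \<in> sets (density P0 (indicator Y))"
      then show "emeasure (density N0 (indicator Y)) B \<le> emeasure (density P0 (indicator Y)) B"
        using YZ by (simp add: emeasure_restricted r(3)) (intro Y(2), auto)
    qed (use A YZ in \<open>simp_all add: P0.finite_measure_restricted N0.finite_measure_restricted r(3)\<close>)
    then show ?thesis using A YZ by (simp add: emeasure_restricted r(3))
  qed
  have eN: "emeasure N A = emeasure N0 (Z \<inter> A) - emeasure P0 (Z \<inter> A)" if A: "A \<in> sets P0" for A
  proof -
    have "emeasure N A = emeasure (density N0 (indicator Z)) A - emeasure (density P0 (indicator Z)) A"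
      unfolding N_def
    proof (rule emeasure_diff_measure)
      fix B assume "B \<in> sets (density N0 (indicator Z))"
      then show "emeasure (density P0 (indicator Z)) B \<le> emeasure (density N0 (indicator Z)) B"
        using YZ by (simp add: emeasure_restricted r(3)) (intro Y(3), auto simp: Z_def)
    qed (use A YZ in \<open>simp_all add: P0.finite_measure_restricted N0.finite_measure_restricted r(3)\<close>)
    then show ?thesis using A YZ by (simp add: emeasure_restricted r(3))
  qed
  have mP: "measure P A = measure P0 (Y \<inter> A) - measure N0 (Y \<inter> A)" if A: "A \<in> sets P0" for A
    using Y(2)[of "Y \<inter> A"] A YZ
    by (simp add: measure_def[of P] eP P0.emeasure_eq_measure N0.emeasure_eq_measure ennreal_minus)
  have mN: "measure N A = measure N0 (Z \<inter> A) - measure P0 (Z \<inter> A)" if A: "A \<in> sets P0" for A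
    using Y(3)[of "Z \<inter> A"] disjnt A YZ
    by (simp add: measure_def[of N] eN P0.emeasure_eq_measure N0.emeasure_eq_measure ennreal_minus r(3))
  have mu: "\<mu> A = measure P0 A - measure N0 A" if "A \<in> sets P0" for A
    using that r(8)[of A] r(1) by (simp add: sets_restrict_Ioo_iff)
  have split: "measure M A = measure M (Y \<inter> A) + measure M (Z \<inter> A)"
    if "finite_measure M" "sets M = sets P0" "A \<in> sets P0" for M A
  proof -
    interpret finite_measure M by fact
    have "A = (Y \<inter> A) \<union> (Z \<inter> A)"
      using sets.sets_into_space[OF that(3)] r(4) by (auto simp: Z_def)
    then show ?thesis
      using finite_measure_Union[of "Y \<inter> A" "Z \<inter> A"] that YZ by (auto simp: Z_def)
  qed
  show ?thesis
  proof (rule that)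
    have "finite_measure P" "finite_measure N"
      using P0.emeasure_finite N0.emeasure_finite
      by (auto intro!: finite_measureI simp: eP eN sets_eq_imp_space_eq[OF sets(1)] sets_eq_imp_space_eq[OF sets(2)])
    then show "sm_rep a b \<mu> P N"
      unfolding sm_rep_def
      using mu split[OF r(6) refl] split[OF r(7,3)] r(1) by (simp add: sets mP mN)
    show "Y \<in> sets borel" "Y \<subseteq> {a<..<b}" using Y(1) r(1) by (simp_all add: sets_restrict_Ioo_iff)
    fix A assume "A \<in> sets borel" "A \<subseteq> {a<..<b}"
    then have A: "A \<in> sets P0" using r(1) by (simp add: sets_restrict_Ioo_iff)
    have e: "A \<inter> Y = Y \<inter> A" "A - Y = Z \<inter> A" using \<open>A \<subseteq> {a<..<b}\<close> by (auto simp: Z_def)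
    show "measure P A + measure N A = \<mu> (A \<inter> Y) - \<mu> (A - Y)"
      unfolding e using A YZ by (simp add: mP mN mu)
  qed
qed

section \<open>Averaging windows\<close>

text \<open>The window is \<open>(1 - \<theta>) x + \<theta> [a, b]\<close>: it contains \<open>x\<close> and stays inside \<open>(a, b)\<close>, so no function
  or measure ever has to be extended beyond the interval, which would create spurious boundary jumps.\<close>

definition win :: "real \<Rightarrow> real \<Rightarrow> real \<Rightarrow> real \<Rightarrow> real set" where
  "win a b \<theta> x = {x - \<theta> * (x - a)..x + \<theta> * (b - x)}"

locale window =
  fixes a b \<theta> :: real
  assumes ab: "a < b" and th: "0 < \<theta>" "\<theta> < 1"
begin

abbreviation \<Omega> :: "real set" where "\<Omega> \<equiv> {a<..<b}"
abbreviation W :: "real \<Rightarrow> real set" where "W \<equiv> win a b \<theta>"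

definition len :: real where "len = \<theta> * (b - a)"
text \<open>The centres whose window contains a given point form an interval of length
  \<open>1 / kap\<close>, so \<open>kap\<close> normalises the adjoint kernel to mass one. The same
  factor comes from differentiating a mean: the ends of the window move with speed 1 - \<theta> and
  the mean divides by \<open>len\<close>.\<close>

definition kap :: real where "kap = (1 - \<theta>) / len"

lemma len_pos: "0 < len" using ab th by (simp add: len_def)

lemma kap_pos: "0 < kap" using len_pos th by (simp add: kap_def)

lemma mem_win_iff: "y \<in> W x \<longleftrightarrow> x \<in> {(y - \<theta> * b) / (1 - \<theta>)..(y - \<theta> * a) / (1 - \<theta>)}"
proof -
  have "1 - \<theta> > 0" using th by simp
  then show ?thesis by (auto simp: win_def field_simps)
qed

lemma indicator_win: "indicator (W x) y = (indicator {(y - \<theta> * b) / (1 - \<theta>)..(y - \<theta> * a) / (1 - \<theta>)} x :: real)"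
  using mem_win_iff[of y x] by (simp add: indicator_def)

lemma win_subset: "x \<in> \<Omega> \<Longrightarrow> W x \<subseteq> \<Omega>"
proof -
  assume x: "x \<in> \<Omega>"
  have "\<theta> * (x - a) < 1 * (x - a)" "\<theta> * (b - x) < 1 * (b - x)"
    using x th by (auto intro!: mult_strict_right_mono)
  then show ?thesis by (auto simp: win_def)
qed

lemma win_borel [measurable]: "W x \<in> sets borel"
  by (simp add: win_def)

lemma win_le: "x - \<theta> * (x - a) \<le> x + \<theta> * (b - x)"
  using len_pos by (simp add: len_def algebra_simps)

lemma emeasure_win: "emeasure lborel (W x) = ennreal len"
  using win_le by (simp add: win_def len_def) (simp add: algebra_simps)

lemma measure_win: "measure lborel (W x) = len"
  using emeasure_win len_pos by (simp add: measure_def)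

lemma dist_win: "x \<in> {a..b} \<Longrightarrow> y \<in> W x \<Longrightarrow> \<bar>x - y\<bar> \<le> len"
proof -
  assume x: "x \<in> {a..b}" and y: "y \<in> W x"
  have "\<theta> * (x - a) \<le> \<theta> * (b - a)" "\<theta> * (b - x) \<le> \<theta> * (b - a)"
    using x th by auto
  then show ?thesis using y by (auto simp: win_def len_def)
qed

text \<open>Points seen only by windows with centre outside \<open>(a, b)\<close> are close to the boundary, where the test
  functions of the flat norm are small; extending these by zero is therefore harmless.\<close>

lemma win_outside_left: "x \<le> a \<Longrightarrow> y \<in> W x \<Longrightarrow> y - a \<le> len"
  and win_outside_right: "b \<le> x \<Longrightarrow> y \<in> W x \<Longrightarrow> b - y \<le> len"
proof -
  assume x: "x \<le> a" and y: "y \<in> W x"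
  have "(1 - \<theta>) * (x - a) \<le> 0" using x th by (simp add: mult_nonneg_nonpos)
  then show "y - a \<le> len" using y by (simp add: win_def len_def algebra_simps)
next
  assume x: "b \<le> x" and y: "y \<in> W x"
  have "(1 - \<theta>) * (b - x) \<le> 0" using x th by (simp add: mult_nonneg_nonpos)
  then show "b - y \<le> len" using y by (simp add: win_def len_def algebra_simps)
qed

section \<open>The adjoint of the window average\<close>

lemma win_kernel_measurable:
  assumes [measurable]: "(\<lambda>y. y) \<in> borel_measurable N"
  shows "(\<lambda>(x, y). indicator (W x) y :: real) \<in> borel_measurable (lborel \<Otimes>\<^sub>M N)"
  unfolding win_def indicator_def atLeastAtMost_iff by measurable

text \<open>Besides sigma-finiteness, N is tied to the Borel sets only by measurability of the
  identity. This covers both \<open>lborel\<close> and finite measures on the trace sigma-algebra of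
  (a, b).\<close>

lemma win_Fubini:
  fixes f v :: "real \<Rightarrow> real"
  assumes "sigma_finite_measure N" "(\<lambda>y. y) \<in> borel_measurable N" "integrable lborel f" "integrable N v"
  shows win_Fubini_integrable1: "integrable lborel (\<lambda>x. f x * (\<integral>y. indicator (W x) y * v y \<partial>N))"
    and win_Fubini_integrable2: "integrable N (\<lambda>y. v y * (\<integral>x. indicator (W x) y * f x \<partial>lborel))"
    and win_Fubini_eq: "(\<integral>x. f x * (\<integral>y. indicator (W x) y * v y \<partial>N) \<partial>lborel)
      = (\<integral>y. v y * (\<integral>x. indicator (W x) y * f x \<partial>lborel) \<partial>N)"
  by (rule kernel_Fubini[where c = 1] ; use assms in \<open>auto intro: win_kernel_measurable lborel.sigma_finite_measure_axioms\<close>)+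

lemma integral_win_dual: "(\<integral>x. indicator (W x) y \<partial>lborel) = 1 / kap"
  and integrable_win_dual: "integrable lborel (\<lambda>x. indicator (W x) y :: real)"
proof -
  have "(y - \<theta> * b) / (1 - \<theta>) \<le> (y - \<theta> * a) / (1 - \<theta>)"
    using th ab by (intro divide_right_mono) auto
  moreover have "(y - \<theta> * a) / (1 - \<theta>) - (y - \<theta> * b) / (1 - \<theta>) = 1 / kap"
    using th by (simp add: kap_def len_def diff_divide_distrib[symmetric] algebra_simps)
  ultimately show "(\<integral>x. indicator (W x) y \<partial>lborel) = 1 / kap"
    "integrable lborel (\<lambda>x. indicator (W x) y :: real)"
    unfolding indicator_win by auto
qed

lemma integrable_win_mult:
  fixes f :: "real \<Rightarrow> real"
  assumes [measurable]: "f \<in> borel_measurable borel" and "\<And>x. \<bar>f x\<bar> \<le> c"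
  shows "integrable lborel (\<lambda>x. indicator (W x) y * f x)"
proof (rule Bochner_Integration.integrable_bound[OF integrable_mult_right[OF integrable_win_dual, of c y]])
  show "(\<lambda>x. indicator (W x) y * f x) \<in> borel_measurable lborel"
    unfolding indicator_win by measurable
qed (use order_trans[OF assms(2) abs_ge_self] in \<open>auto simp: indicator_def\<close>)

text \<open>With the factor \<open>kap\<close> the kernel is a probability density in x, and a mean
  of values within e of z is within e of z. The choice z = 0 gives sup bounds, z = \<phi> y the flat
  distance, and a z half way between two bounds turns the two-sided estimate into a one-sided
  one.\<close>

lemma win_dual_close:
  fixes f :: "real \<Rightarrow> real"
  assumes [measurable]: "f \<in> borel_measurable borel" and f: "\<And>x. \<bar>f x\<bar> \<le> c"
    and d: "\<And>x. y \<in> W x \<Longrightarrow> \<bar>f x - z\<bar> \<le> e"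
  shows "\<bar>kap * (\<integral>x. indicator (W x) y * f x \<partial>lborel) - z\<bar> \<le> e"
proof -
  have i: "integrable lborel (\<lambda>x. indicator (W x) y * f x)"
    using assms by (intro integrable_win_mult)
  have i2: "integrable lborel (\<lambda>x. indicator (W x) y * z)" "integrable lborel (\<lambda>x. indicator (W x) y * e)"
    using integrable_win_dual by auto
  have z: "(\<integral>x. indicator (W x) y * z \<partial>lborel) = z / kap"  "(\<integral>x. indicator (W x) y * e \<partial>lborel) = e / kap"
    using integral_win_dual[of y] by simp_all
  have "\<bar>(\<integral>x. indicator (W x) y * f x \<partial>lborel) - z / kap\<bar>
      = \<bar>\<integral>x. indicator (W x) y * f x - indicator (W x) y * z \<partial>lborel\<bar>"
    using i i2 z by simp
  also have "\<dots> \<le> (\<integral>x. \<bar>indicator (W x) y * f x - indicator (W x) y * z\<bar> \<partial>lborel)"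
    by (rule integral_abs_bound)
  also have "\<dots> \<le> (\<integral>x. indicator (W x) y * e \<partial>lborel)"
    using i i2 d by (intro integral_mono integrable_abs Bochner_Integration.integrable_diff) (auto simp: indicator_def)
  finally have "\<bar>(\<integral>x. indicator (W x) y * f x \<partial>lborel) - z / kap\<bar> \<le> e / kap" by (simp only: z)
  then have "kap * \<bar>(\<integral>x. indicator (W x) y * f x \<partial>lborel) - z / kap\<bar> \<le> kap * (e / kap)"
    using kap_pos by (intro mult_left_mono) auto
  moreover have "kap * \<bar>(\<integral>x. indicator (W x) y * f x \<partial>lborel) - z / kap\<bar>
     = \<bar>kap * ((\<integral>x. indicator (W x) y * f x \<partial>lborel) - z / kap)\<bar>"
    using kap_pos by (simp add: abs_mult)
  ultimately show ?thesis using kap_pos by (simp add: right_diff_distrib)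
qed

lemma win_dual_measurable [measurable]:
  fixes f :: "real \<Rightarrow> real"
  assumes "f \<in> borel_measurable borel"
  shows "(\<lambda>y. \<integral>x. indicator (W x) y * f x \<partial>lborel) \<in> borel_measurable borel"
proof -
  have [measurable]: "f \<in> borel_measurable lborel" using assms by simp
  show ?thesis unfolding win_def indicator_def atLeastAtMost_iff by measurable
qed

text \<open>Fubini, applied to P and N separately, moves the averaging from the measure to the test
  function. Weak differentiation and flat convergence of the sampled density
  \<open>kap * \<mu> (W x)\<close> are both read off from \<Phi>. The test function is cut off at
  the boundary because only centres in (a, b) are integrated.\<close>

lemma win_adjoint:
  assumes rep: "sm_rep a b \<mu> P N"
    and m: "\<phi> \<in> borel_measurable (restrict_space borel \<Omega>)"
    and bnd: "\<And>x. x \<in> \<Omega> \<Longrightarrow> \<bar>\<phi> x\<bar> \<le> c"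
  defines "\<Phi> \<equiv> \<lambda>y. kap * (\<integral>x. indicator (W x) y * (indicator \<Omega> x * \<phi> x) \<partial>lborel)"
  shows win_adjoint_integrable: "set_integrable lborel \<Omega> (\<lambda>x. \<phi> x * (kap * \<mu> (W x)))"
    and win_adjoint_eq: "(LINT x:\<Omega>|lborel. \<phi> x * (kap * \<mu> (W x))) = integral\<^sup>L P \<Phi> - integral\<^sup>L N \<Phi>"
    and win_adjoint_measurable: "\<Phi> \<in> borel_measurable (restrict_space borel \<Omega>)"
    and win_adjoint_bound: "\<bar>\<Phi> y\<bar> \<le> max c 0"
proof -
  let ?f = "\<lambda>x. indicator \<Omega> x * \<phi> x"
  note r = sm_repD[OF rep]
  have [measurable]: "?f \<in> borel_measurable borel"
    using m by (subst (asm) borel_measurable_restrict_space_iff) auto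
  have fb: "\<bar>?f x\<bar> \<le> max c 0" for x using bnd[of x] by (auto simp: indicator_def)
  have f: "integrable lborel ?f"
  proof (rule Bochner_Integration.integrable_bound[of _ "\<lambda>x. indicator \<Omega> x * c"])
    show "integrable lborel (\<lambda>x. indicator \<Omega> x * c)" using ab by auto
    show "?f \<in> borel_measurable lborel" by measurable
    have "norm (?f x) \<le> norm (indicator \<Omega> x * c)" for x
      using bnd[of x] by (auto simp: indicator_def)
    then show "AE x in lborel. norm (?f x) \<le> norm (indicator \<Omega> x * c)" by simp
  qed
  have \<Phi>m: "\<Phi> \<in> borel_measurable borel" unfolding \<Phi>_def by measurable
  then show \<Phi>r: "\<Phi> \<in> borel_measurable (restrict_space borel \<Omega>)" by (rule measurable_restrict_space1)
  show \<Phi>b: "\<bar>\<Phi> y\<bar> \<le> max c 0" for y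
    unfolding \<Phi>_def using win_dual_close[of ?f "max c 0" y 0 "max c 0"] fb by simp
  have *: "integrable lborel (\<lambda>x. ?f x * (kap * measure M (W x))) \<and>
      (\<integral>x. ?f x * (kap * measure M (W x)) \<partial>lborel) = integral\<^sup>L M \<Phi>"
    if M: "finite_measure M" "sets M = sets (restrict_space borel \<Omega>)" for M
  proof -
    interpret finite_measure M by fact
    have id: "(\<lambda>y. y) \<in> borel_measurable M"
      unfolding measurable_cong_sets[OF M(2) refl] by (intro measurable_restrict_space1) simp
    have sp: "space M = \<Omega>" using sets_eq_imp_space_eq[OF M(2)] by (simp add: space_restrict_space)
    have WM: "W x \<in> sets M" if "x \<in> \<Omega>" for x using win_subset[OF that] M(2) by (simp add: sets_restrict_Ioo_iff)
    have e: "kap * (?f x * (\<integral>y. indicator (W x) y * 1 \<partial>M)) = ?f x * (kap * measure M (W x))" for x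
      using WM[of x] sets.sets_into_space[OF WM[of x]] by (cases "x \<in> \<Omega>") (auto simp: Int_absorb2)
    note F = win_Fubini[OF sigma_finite_measure_axioms id f, of "\<lambda>_. 1"]
    have one: "integrable M (\<lambda>_. 1 :: real)" by simp
    have "integrable lborel (\<lambda>x. kap * (?f x * (\<integral>y. indicator (W x) y * 1 \<partial>M)))"
      using F(1)[OF one] by (intro integrable_mult_right)
    moreover have "(\<integral>x. kap * (?f x * (\<integral>y. indicator (W x) y * 1 \<partial>M)) \<partial>lborel) = integral\<^sup>L M \<Phi>"
      unfolding integral_mult_right_zero F(3)[OF one] by (simp add: \<Phi>_def)
    ultimately show ?thesis unfolding e by simp
  qed
  have e: "indicator \<Omega> x *\<^sub>R (\<phi> x * (kap * \<mu> (W x)))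
     = ?f x * (kap * measure P (W x)) - ?f x * (kap * measure N (W x))" for x
    using win_subset[of x] r(8)[of "W x"] by (cases "x \<in> \<Omega>") (simp_all add: right_diff_distrib)
  show "set_integrable lborel \<Omega> (\<lambda>x. \<phi> x * (kap * \<mu> (W x)))"
    unfolding set_integrable_def e using *[OF r(6,1)] *[OF r(7,2)] by auto
  show "(LINT x:\<Omega>|lborel. \<phi> x * (kap * \<mu> (W x))) = integral\<^sup>L P \<Phi> - integral\<^sup>L N \<Phi>"
    unfolding set_lebesgue_integral_def e using *[OF r(6,1)] *[OF r(7,2)] by auto
qed

end

section \<open>Derivative, sup bound and flat distance of the averages\<close>

lemma weak_deriv_cong:
  assumes "weak_deriv a b u v" and "\<And>x. x \<in> {a<..<b} \<Longrightarrow> v x = w x"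
  shows "weak_deriv a b u w"
proof -
  have 1: "set_integrable lborel {a<..<b} w"
    using assms by (auto simp: weak_deriv_def intro: set_integrable_cong[THEN iffD1, of _ _ _ _ v])
  have 2: "(LINT x:{a<..<b}|lborel. v x * \<phi> x) = (LINT x:{a<..<b}|lborel. w x * \<phi> x)" for \<phi>
    by (intro set_lebesgue_integral_cong) (auto simp: assms(2))
  show ?thesis using assms(1) 1 by (auto simp: weak_deriv_def 2)
qed

lemma cc1_testD:
  assumes "cc1_test a b \<phi>"
  shows "\<And>x. (\<phi> has_real_derivative deriv \<phi> x) (at x)" "\<And>x. isCont \<phi> x" "\<And>x. isCont (deriv \<phi>) x"
    "\<And>x. x \<notin> {a<..<b} \<Longrightarrow> \<phi> x = 0" "\<And>x. x \<notin> {a<..<b} \<Longrightarrow> deriv \<phi> x = 0"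
proof -
  from assms obtain c d where cd: "a < c" "d < b" "\<And>x. x \<notin> {c..d} \<Longrightarrow> \<phi> x = 0"
    and dd: "\<And>x. \<phi> differentiable at x" "continuous_on UNIV (deriv \<phi>)"
    by (auto simp: cc1_test_def)
  show D: "(\<phi> has_real_derivative deriv \<phi> x) (at x)" for x
    using dd(1)[of x] DERIV_deriv_iff_real_differentiable by blast
  then show "isCont \<phi> x" for x using DERIV_isCont by blast
  show "isCont (deriv \<phi>) x" for x
    using dd(2) by (simp add: continuous_on_eq_continuous_at)
  show "\<phi> x = 0" if "x \<notin> {a<..<b}" for x using cd that by auto
  show "deriv \<phi> x = 0" if "x \<notin> {a<..<b}" for x
  proof -
    have "((\<lambda>_. 0) has_real_derivative 0) (at x)" by simp
    then have "(\<phi> has_real_derivative 0) (at x)"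
      by (rule has_field_derivative_transform_within_open[of _ _ _ "- {c..d}"]) (use that cd in auto)
    then show ?thesis using D[of x] DERIV_unique by blast
  qed
qed

context window
begin

text \<open>\<alpha> inverts the right end point of the window as a function of its centre, \<beta>
  the left one; between them lie the centres that see y.\<close>

definition \<alpha> :: "real \<Rightarrow> real" where "\<alpha> y = (y - \<theta> * b) / (1 - \<theta>)"
definition \<beta> :: "real \<Rightarrow> real" where "\<beta> y = (y - \<theta> * a) / (1 - \<theta>)"

lemma alpha_le_beta: "\<alpha> y \<le> \<beta> y"
  unfolding \<alpha>_def \<beta>_def using th ab by (intro divide_right_mono) auto

lemma integral_win_FTC:
  assumes "\<And>x. (G has_real_derivative g x) (at x)" "\<And>x. isCont g x"
  shows "(\<integral>x. indicator (W x) y * g x \<partial>lborel) = G (\<beta> y) - G (\<alpha> y)"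
  unfolding indicator_win using integral_FTC_Icc_real[OF alpha_le_beta[of y], of G g] assms
  by (simp add: \<alpha>_def \<beta>_def mult.commute)

text \<open>Averaging commutes with differentiation up to the factor \<open>1 - \<theta>\<close> of the rescaling; applying this to the
  test function instead of \<open>u\<close> avoids choosing a good representative of \<open>u\<close>.\<close>

lemma smoothed_test:
  assumes "cc1_test a b \<phi>"
  defines "\<psi> \<equiv> \<lambda>y. kap * (\<integral>x. indicator (W x) y * \<phi> x \<partial>lborel)"
  shows "cc1_test a b \<psi>" "deriv \<psi> y = (\<integral>x. indicator (W x) y * deriv \<phi> x \<partial>lborel) / len"
proof -
  note t = cc1_testD[OF assms(1)]
  from assms obtain c d where cd: "a < c" "d < b" "\<And>x. x \<notin> {c..d} \<Longrightarrow> \<phi> x = 0"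
    by (auto simp: cc1_test_def)
  \<comment> \<open>With an antiderivative of \<phi> the average becomes a difference of two values
    of F, and \<psi> is differentiated by the chain rule.\<close>
  obtain F where F: "\<And>x. (F has_real_derivative \<phi> x) (at x)"
    using einterval_antiderivative[of "-\<infinity>" "\<infinity>" \<phi>] t(2)
    by (auto simp: has_real_derivative_iff_has_vector_derivative)
  have \<psi>: "\<psi> = (\<lambda>y. kap * (F (\<beta> y) - F (\<alpha> y)))"
    unfolding \<psi>_def using integral_win_FTC[OF F t(2)] by simp
  have D\<alpha>: "(\<alpha> has_real_derivative 1 / (1 - \<theta>)) (at y)" for y
    unfolding \<alpha>_def[abs_def] using th by (auto intro!: derivative_eq_intros)
  have D\<beta>: "(\<beta> has_real_derivative 1 / (1 - \<theta>)) (at y)" for y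
    unfolding \<beta>_def[abs_def] using th by (auto intro!: derivative_eq_intros)
  have D: "(\<psi> has_real_derivative (\<phi> (\<beta> y) - \<phi> (\<alpha> y)) / len) (at y)" for y
  proof -
    have "((\<lambda>y. kap * (F (\<beta> y) - F (\<alpha> y))) has_real_derivative
        kap * (\<phi> (\<beta> y) * (1 / (1 - \<theta>)) - \<phi> (\<alpha> y) * (1 / (1 - \<theta>)))) (at y)"
      by (intro DERIV_cmult DERIV_diff DERIV_chain2[OF F] D\<alpha> D\<beta>)
    moreover have "kap * (\<phi> (\<beta> y) * (1 / (1 - \<theta>)) - \<phi> (\<alpha> y) * (1 / (1 - \<theta>))) = (\<phi> (\<beta> y) - \<phi> (\<alpha> y)) / len"
      using th by (simp add: kap_def diff_divide_distrib[symmetric])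
    ultimately show ?thesis unfolding \<psi> by simp
  qed
  have d\<psi>: "deriv \<psi> = (\<lambda>y. (\<phi> (\<beta> y) - \<phi> (\<alpha> y)) / len)"
    using D DERIV_imp_deriv by blast
  then show "deriv \<psi> y = (\<integral>x. indicator (W x) y * deriv \<phi> x \<partial>lborel) / len"
    using integral_win_FTC[OF t(1,3)] by simp
  have c\<phi>: "continuous_on UNIV \<phi>" using t(2) by (simp add: continuous_at_imp_continuous_on)
  have "continuous_on UNIV (deriv \<psi>)"
    unfolding d\<psi> using th len_pos
    by (intro continuous_intros continuous_on_compose2[OF c\<phi>]) (auto simp: \<alpha>_def[abs_def] \<beta>_def[abs_def] intro!: continuous_intros)
  moreover have "\<psi> differentiable at x" for x
    using D real_differentiable_def by blast
  \<comment> \<open>A window with centre in [c, d] reaches at most from the left end of the window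
    of c to the right end of the window of d, and both still lie inside (a, b). So compact support
    survives the averaging.\<close>
  moreover have "\<psi> y = 0" if "y \<notin> {c - \<theta> * (c - a)..d + \<theta> * (b - d)}" for y
  proof -
    have "indicator (W x) y * \<phi> x = 0" for x
    proof (rule ccontr)
      assume "indicator (W x) y * \<phi> x \<noteq> 0"
      then have y: "y \<in> W x" and x: "x \<in> {c..d}" using cd(3) by (auto simp: indicator_def split: if_splits)
      have "(1 - \<theta>) * c \<le> (1 - \<theta>) * x" "(1 - \<theta>) * x \<le> (1 - \<theta>) * d"
        using x th by auto
      then show False using y that by (auto simp: win_def algebra_simps)
    qed
    then have "(\<lambda>x. indicator (W x) y * \<phi> x) = (\<lambda>_. 0)" by blast
    then show ?thesis by (simp add: \<psi>_def)
  qed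
  moreover have "a < c - \<theta> * (c - a)" "d + \<theta> * (b - d) < b"
  proof -
    have "\<theta> * (c - a) < 1 * (c - a)" "\<theta> * (b - d) < 1 * (b - d)"
      using cd(1,2) th by (auto intro!: mult_strict_right_mono)
    then show "a < c - \<theta> * (c - a)" and "d + \<theta> * (b - d) < b" by auto
  qed
  ultimately show "cc1_test a b \<psi>" unfolding cc1_test_def by blast
qed

definition avg :: "(real \<Rightarrow> real) \<Rightarrow> real \<Rightarrow> real" where
  "avg u x = (LINT y:W x|lborel. u y) / len"

text \<open>For centres in (a, b) the window stays inside, so u may be cut off. This yields the
  function integrable on the whole line to which Fubini applies.\<close>

lemma avg_eq: "x \<in> \<Omega> \<Longrightarrow> avg u x = (\<integral>y. indicator (W x) y * (indicator \<Omega> y * u y) \<partial>lborel) / len"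
  unfolding avg_def set_lebesgue_integral_def using win_subset[of x]
  by (auto intro!: arg_cong2[where f = "(/)"] Bochner_Integration.integral_cong simp: indicator_def)

lemma integrable_indicator_Omega: "integrable lborel (indicator \<Omega> :: real \<Rightarrow> real)"
  using ab by simp

lemma set_integrable_avg:
  assumes "set_integrable lborel \<Omega> u"
  shows "set_integrable lborel \<Omega> (avg u)"
proof -
  have "integrable lborel (\<lambda>x. (indicator \<Omega> x * (\<integral>y. indicator (W x) y * (indicator \<Omega> y * u y) \<partial>lborel)) / len)"
    using assms integrable_indicator_Omega
    by (intro integrable_divide win_Fubini_integrable1)
      (auto simp: set_integrable_def lborel.sigma_finite_measure_axioms)
  also have "(\<lambda>x. (indicator \<Omega> x * (\<integral>y. indicator (W x) y * (indicator \<Omega> y * u y) \<partial>lborel)) / len)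
     = (\<lambda>x. indicator \<Omega> x *\<^sub>R avg u x)"
    by (auto simp: avg_eq indicator_def)
  finally show ?thesis by (simp add: set_integrable_def)
qed

lemma set_integrable_continuous:
  fixes f :: "real \<Rightarrow> real"
  assumes "\<And>x. isCont f x"
  shows "set_integrable lborel \<Omega> f"
proof -
  have "set_integrable lborel {a..b} f"
    using assms by (intro borel_integrable_atLeastAtMost') (simp add: continuous_at_imp_continuous_on)
  then show ?thesis by (rule set_integrable_subset) auto
qed

text \<open>Fubini moves the mean from u to \<phi>', where it becomes the derivative of the smoothed
  test function \<psi>. As \<psi> is again admissible, the formula defining Du applies to it, and
  the adjoint identity turns the integral of \<psi> against \<mu> into the integral of \<phi>
  against the sampled density.\<close>

lemma weak_deriv_avg:
  assumes "BV_deriv a b u \<mu>"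
  shows "weak_deriv a b (avg u) (\<lambda>x. kap * \<mu> (W x))"
proof -
  have u: "set_integrable lborel \<Omega> u" and mu: "signed_measure a b \<mu>"
    and byparts: "\<And>\<phi>. cc1_test a b \<phi> \<Longrightarrow> (LINT x:\<Omega>|lborel. u x * deriv \<phi> x) = - sint a b \<mu> \<phi>"
    using assms by (auto simp: BV_deriv_def)
  obtain P N where rep: "sm_rep a b \<mu> P N" using mu by (auto simp: signed_measure_def)
  have "set_integrable lborel \<Omega> (\<lambda>x. kap * \<mu> (W x))"
    using win_adjoint_integrable[OF rep, of "\<lambda>_. 1" 1] by simp
  moreover have "(LINT x:\<Omega>|lborel. avg u x * deriv \<phi> x) = - (LINT x:\<Omega>|lborel. (kap * \<mu> (W x)) * \<phi> x)"
    if \<phi>: "cc1_test a b \<phi>" for \<phi>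
  proof -
    note t = cc1_testD[OF \<phi>]
    define \<psi> where "\<psi> = (\<lambda>y. kap * (\<integral>x. indicator (W x) y * \<phi> x \<partial>lborel))"
    note \<psi> = smoothed_test[OF \<phi>, folded \<psi>_def]
    let ?u = "\<lambda>y. indicator \<Omega> y * u y" and ?d = "\<lambda>x. indicator \<Omega> x * deriv \<phi> x"
    have "?d = deriv \<phi>" using t(5) by (intro ext) (auto simp: indicator_def)
    have "(LINT x:\<Omega>|lborel. avg u x * deriv \<phi> x)
        = (\<integral>x. (?d x * (\<integral>y. indicator (W x) y * ?u y \<partial>lborel)) / len \<partial>lborel)"
      unfolding set_lebesgue_integral_def
      by (intro Bochner_Integration.integral_cong) (auto simp: avg_eq indicator_def)
    also have "\<dots> = (\<integral>y. ?u y * (\<integral>x. indicator (W x) y * ?d x \<partial>lborel) \<partial>lborel) / len"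
      using u set_integrable_continuous[OF t(3)]
      by (subst integral_divide_zero, subst win_Fubini_eq)
        (auto simp: set_integrable_def lborel.sigma_finite_measure_axioms)
    also have "\<dots> = (LINT y:\<Omega>|lborel. u y * deriv \<psi> y)"
      unfolding set_lebesgue_integral_def \<psi>(2) integral_divide_zero[symmetric] fun_cong[OF \<open>?d = deriv \<phi>\<close>]
      by (intro Bochner_Integration.integral_cong) auto
    also have "\<dots> = - sint a b \<mu> \<psi>" by (rule byparts) (rule \<psi>)
    also have "sint a b \<mu> \<psi> = (LINT x:\<Omega>|lborel. \<phi> x * (kap * \<mu> (W x)))"
    proof -
      have \<phi>0: "(\<lambda>x. indicator \<Omega> x * \<phi> x) = \<phi>" using t(4) by (intro ext) (auto simp: indicator_def)
      have c\<phi>: "continuous_on A \<phi>" for A using t(2) by (simp add: continuous_at_imp_continuous_on)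
      have m: "\<phi> \<in> borel_measurable (restrict_space borel \<Omega>)"
        using c\<phi>[of UNIV] by (intro measurable_restrict_space1 borel_measurable_continuous_onI)
      obtain c where c: "\<And>x. x \<in> \<Omega> \<Longrightarrow> \<bar>\<phi> x\<bar> \<le> c"
        using compact_imp_bounded[OF compact_continuous_image[OF c\<phi> compact_Icc[of a b]]]
        unfolding bounded_iff by force
      have adj: "(LINT x:\<Omega>|lborel. \<phi> x * (kap * \<mu> (W x))) = integral\<^sup>L P \<psi> - integral\<^sup>L N \<psi>"
        "\<psi> \<in> borel_measurable (restrict_space borel \<Omega>)" "\<And>y. \<bar>\<psi> y\<bar> \<le> max c 0"
        using win_adjoint_eq[OF rep m c] win_adjoint_measurable[OF rep m c] win_adjoint_bound[OF rep m c]
        by (simp_all add: fun_cong[OF \<phi>0] \<psi>_def)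
      show ?thesis unfolding adj(1) by (rule sint_eq[OF rep adj(2)]) (rule adj(3))
    qed
    also have "(LINT x:\<Omega>|lborel. \<phi> x * (kap * \<mu> (W x))) = (LINT x:\<Omega>|lborel. (kap * \<mu> (W x)) * \<phi> x)"
      by (simp add: mult.commute)
    finally show ?thesis .
  qed
  ultimately show ?thesis
    unfolding weak_deriv_def using set_integrable_avg[OF u] by blast
qed

lemma ess_bound_avg:
  assumes u: "set_integrable lborel \<Omega> u" and "ess_bound a b K u"
  shows "ess_bound a b K (avg u)"
proof -
  have "\<bar>avg u x\<bar> \<le> K" if x: "x \<in> \<Omega>" for x
  proof -
    let ?u = "\<lambda>y. indicator \<Omega> y * u y"
    have W: "integrable lborel (\<lambda>y. indicator (W x) y * K)"
      using emeasure_win[of x] by auto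
    have "\<bar>\<integral>y. indicator (W x) y * ?u y \<partial>lborel\<bar> \<le> (\<integral>y. \<bar>indicator (W x) y * ?u y\<bar> \<partial>lborel)"
      by (rule integral_abs_bound)
    also have "\<dots> \<le> (\<integral>y. indicator (W x) y * K \<partial>lborel)"
    proof (rule integral_mono_AE')
      show "AE y in lborel. \<bar>indicator (W x) y * ?u y\<bar> \<le> indicator (W x) y * K"
        using assms(2) unfolding ess_bound_def
        by eventually_elim (use win_subset[OF x] in \<open>auto simp: indicator_def\<close>)
      then show "AE y in lborel. 0 \<le> indicator (W x) y * K"
        by eventually_elim (auto intro: order_trans[OF abs_ge_zero])
    qed (rule W)
    also have "\<dots> = len * K" using measure_win[of x] by simp
    finally show ?thesis using len_pos by (simp add: avg_eq[OF x] field_simps)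
  qed
  then show ?thesis by (simp add: ess_bound_def)
qed

text \<open>Testing the smoothed measure with \<phi> is testing \<gamma> with the adjoint average
  \<Phi>. Since \<phi> is 1-Lipschitz, \<Phi> and \<phi> differ by at most \<open>len\<close>, and
  integrating this over P and N gives the bound.\<close>

lemma flat_norm_smoothed:
  assumes rep: "sm_rep a b \<gamma> P N"
    and g: "\<And>x. x \<in> \<Omega> \<Longrightarrow> g x = kap * \<gamma> (W x)"
  shows "\<bar>flat_norm a b (\<lambda>A. ac_measure g A - \<gamma> A)\<bar> \<le> len * (measure P \<Omega> + measure N \<Omega>)"
proof -
  note r = sm_repD[OF rep]
  have "set_integrable lborel \<Omega> (\<lambda>x. kap * \<gamma> (W x))"
    using win_adjoint_integrable[OF rep, of "\<lambda>_. 1" 1] by simp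
  then have gi: "set_integrable lborel \<Omega> g"
    using g by (auto intro: set_integrable_cong[THEN iffD1, of _ _ _ _ "\<lambda>x. kap * \<gamma> (W x)"])
  have sg: "signed_measure a b \<gamma>" using rep by (auto simp: signed_measure_def)
  have sd: "signed_measure a b (\<lambda>A. ac_measure g A - \<gamma> A)"
    using sm_rep_diff[OF sm_rep_ac_measure[OF gi] rep] by (auto simp: signed_measure_def)
  let ?S = "{sint a b (\<lambda>A. ac_measure g A - \<gamma> A) \<phi> | \<phi>. flat_test a b \<phi>}"
  let ?B = "len * (measure P \<Omega> + measure N \<Omega>)"
  have bound: "sint a b (\<lambda>A. ac_measure g A - \<gamma> A) \<phi> \<le> ?B" if "flat_test a b \<phi>" for \<phi>
  proof -
    from that obtain M L where lp: "M + L \<le> 1" "\<And>x. x \<in> {a..b} \<Longrightarrow> \<bar>\<phi> x\<bar> \<le> M"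
      "\<And>x y. x \<in> {a..b} \<Longrightarrow> y \<in> {a..b} \<Longrightarrow> \<bar>\<phi> x - \<phi> y\<bar> \<le> L * \<bar>x - y\<bar>" and z: "\<phi> a = 0" "\<phi> b = 0"
      by (auto simp: flat_test_def)
    \<comment> \<open>The sup bound and the Lipschitz constant share the budget 1, so M being
      nonnegative leaves at most 1 for L.\<close>
    have "0 \<le> M" using lp(2)[of a] ab by auto
    then have "L \<le> 1" using lp(1) by simp
    then have lip: "\<bar>\<phi> x - \<phi> y\<bar> \<le> \<bar>x - y\<bar>" if "x \<in> {a..b}" "y \<in> {a..b}" for x y
      using lp(3)[OF that] mult_right_mono[OF \<open>L \<le> 1\<close> abs_ge_zero, of "x - y"] by (metis mult_1 order_trans)
    have bnd: "\<bar>\<phi> x\<bar> \<le> M" if "x \<in> \<Omega>" for x using lp(2)[of x] that by auto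
    have "continuous_on \<Omega> \<phi>"
      unfolding continuous_on_iff
    proof (intro ballI allI impI)
      fix x e :: real assume x: "x \<in> \<Omega>" "0 < e"
      show "\<exists>d>0. \<forall>x'\<in>\<Omega>. dist x' x < d \<longrightarrow> dist (\<phi> x') (\<phi> x) < e"
        using x by (intro exI[of _ e]) (auto simp: dist_real_def intro!: le_less_trans[OF lip])
    qed
    then have m: "\<phi> \<in> borel_measurable (restrict_space borel \<Omega>)"
      by (rule borel_measurable_continuous_on_restrict)
    define \<Phi> where "\<Phi> = (\<lambda>y. kap * (\<integral>x. indicator (W x) y * (indicator \<Omega> x * \<phi> x) \<partial>lborel))"
    have adj: "(LINT x:\<Omega>|lborel. \<phi> x * (kap * \<gamma> (W x))) = integral\<^sup>L P \<Phi> - integral\<^sup>L N \<Phi>"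
        "\<Phi> \<in> borel_measurable (restrict_space borel \<Omega>)" "\<And>y. \<bar>\<Phi> y\<bar> \<le> max M 0"
      using win_adjoint_eq[OF rep m bnd] win_adjoint_measurable[OF rep m bnd] win_adjoint_bound[OF rep m bnd]
      by (simp_all add: \<Phi>_def)
    have close: "\<bar>\<Phi> y - \<phi> y\<bar> \<le> len" if y: "y \<in> \<Omega>" for y
      unfolding \<Phi>_def
    proof (rule win_dual_close)
      show "(\<lambda>x. indicator \<Omega> x * \<phi> x) \<in> borel_measurable borel"
        using m by (subst (asm) borel_measurable_restrict_space_iff) auto
      show "\<bar>indicator \<Omega> x * \<phi> x\<bar> \<le> M" for x using bnd[of x] \<open>0 \<le> M\<close> by (auto simp: indicator_def)
      fix x assume yW: "y \<in> W x"
      consider "x \<in> \<Omega>" | "x \<le> a" | "b \<le> x" by force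
      then show "\<bar>indicator \<Omega> x * \<phi> x - \<phi> y\<bar> \<le> len"
      proof cases
        case 1
        then show ?thesis using lip[of x y] dist_win[of x y] y yW by auto
      next
        case 2
        then show ?thesis using lip[of a y] win_outside_left[OF 2 yW] y z by auto
      next
        case 3
        then show ?thesis using lip[of b y] win_outside_right[OF 3 yW] y z by auto
      qed
    qed
    have i: "integrable Q \<phi>" "integrable Q \<Phi>" if "finite_measure Q" "sets Q = sets (restrict_space borel \<Omega>)" for Q
      using that adj(3)
      by (auto intro!: integrable_finite_measure_bounded[OF that m] integrable_finite_measure_bounded[OF that adj(2)] bnd)
    have db: "\<bar>integral\<^sup>L Q \<Phi> - integral\<^sup>L Q \<phi>\<bar> \<le> len * measure Q \<Omega>"
      if Q: "finite_measure Q" "sets Q = sets (restrict_space borel \<Omega>)" for Q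
    proof -
      interpret finite_measure Q by fact
      have sp: "space Q = \<Omega>" using sets_eq_imp_space_eq[OF Q(2)] by (simp add: space_restrict_space)
      have "\<bar>integral\<^sup>L Q \<Phi> - integral\<^sup>L Q \<phi>\<bar> = \<bar>\<integral>x. \<Phi> x - \<phi> x \<partial>Q\<bar>"
        using i[OF Q] by simp
      also have "\<dots> \<le> (\<integral>x. \<bar>\<Phi> x - \<phi> x\<bar> \<partial>Q)" by (rule integral_abs_bound)
      also have "\<dots> \<le> (\<integral>x. len \<partial>Q)"
        using i[OF Q] close sp by (intro integral_mono) auto
      finally show ?thesis by (simp add: sp mult.commute)
    qed
    have "sint a b (\<lambda>A. ac_measure g A - \<gamma> A) \<phi> = sint a b (ac_measure g) \<phi> - sint a b \<gamma> \<phi>"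
      by (rule sint_diff[OF signed_measure_ac_measure[OF gi] sg m]) (rule bnd)
    also have "sint a b (ac_measure g) \<phi> = (LINT x:\<Omega>|lborel. \<phi> x * g x)"
      by (rule sint_ac_measure[OF gi m]) (rule bnd)
    also have "\<dots> = (LINT x:\<Omega>|lborel. \<phi> x * (kap * \<gamma> (W x)))"
      by (intro set_lebesgue_integral_cong) (auto simp: g)
    also have "sint a b \<gamma> \<phi> = integral\<^sup>L P \<phi> - integral\<^sup>L N \<phi>"
      by (rule sint_eq[OF rep m]) (rule bnd)
    finally show ?thesis
      unfolding adj(1) using db[OF r(6,1)] db[OF r(7,2)] by (simp add: distrib_left)
  qed
  \<comment> \<open>The zero test function makes the set under the supremum nonempty and gives the
    lower bound 0 needed for the absolute value.\<close>
  have "flat_test a b (\<lambda>_. 0)" unfolding flat_test_def by (auto intro!: exI[of _ 0])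
  then have 0: "0 \<in> ?S" using sint_zero[OF sd] by force
  have "flat_norm a b (\<lambda>A. ac_measure g A - \<gamma> A) \<le> ?B"
    unfolding flat_norm_def using 0 bound by (intro cSup_least) auto
  moreover have "0 \<le> flat_norm a b (\<lambda>A. ac_measure g A - \<gamma> A)"
    unfolding flat_norm_def using bound by (intro cSup_upper[OF 0] bdd_aboveI[of _ ?B]) auto
  ultimately show ?thesis by simp
qed

end

section \<open>Estimates and convergence in Lebesgue spaces\<close>

context window
begin

text \<open>After Fubini each point is weighted by the length of the set of centres in (a, b) that
  see it, divided by \<open>len\<close>. That length is at most \<open>1 / kap\<close>, so averaging
  gains at most the factor 1 / (1 - \<theta>). Points near the boundary may lose, as some of their
  centres lie outside.\<close>

lemma avg_integral_le:
  assumes v: "set_integrable lborel \<Omega> v" and pos: "\<And>y. y \<in> \<Omega> \<Longrightarrow> 0 \<le> v y"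
  shows "(1 - \<theta>) * (LINT x:\<Omega>|lborel. avg v x) \<le> (LINT x:\<Omega>|lborel. v x)"
proof -
  let ?v = "\<lambda>y. indicator \<Omega> y * v y"
  have vi: "integrable lborel ?v" using v by (simp add: set_integrable_def)
  note F = win_Fubini[OF lborel.sigma_finite_measure_axioms _ integrable_indicator_Omega vi, simplified]
  have dual: "(\<integral>x. indicator (W x) y * indicator \<Omega> x \<partial>lborel) \<le> 1 / kap" for y
    unfolding integral_win_dual[of y, symmetric]
    using integrable_win_dual by (intro integral_mono integrable_win_mult[of _ 1]) (auto simp: indicator_def)
  have "(LINT x:\<Omega>|lborel. avg v x)
      = (\<integral>x. (indicator \<Omega> x * (\<integral>y. indicator (W x) y * ?v y \<partial>lborel)) / len \<partial>lborel)"
    unfolding set_lebesgue_integral_def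
    by (intro Bochner_Integration.integral_cong) (auto simp: avg_eq indicator_def)
  also have "\<dots> = (\<integral>y. ?v y * (\<integral>x. indicator (W x) y * indicator \<Omega> x \<partial>lborel) \<partial>lborel) / len"
    by (simp add: F)
  also have "\<dots> \<le> (\<integral>y. ?v y * (1 / kap) \<partial>lborel) / len"
    using len_pos F(2) vi dual pos
    by (intro divide_right_mono integral_mono mult_left_mono) (auto simp: indicator_def)
  also have "\<dots> = (LINT x:\<Omega>|lborel. v x) / (1 - \<theta>)"
    unfolding set_lebesgue_integral_def using len_pos by (simp add: kap_def)
  finally show ?thesis using th by (simp add: field_simps)
qed

lemma set_integrable_win:
  fixes v :: "real \<Rightarrow> real"
  assumes v: "set_integrable lborel \<Omega> v" and x: "x \<in> \<Omega>"
  shows "set_integrable lborel (W x) v"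
  by (rule set_integrable_subset[OF v _ win_subset[OF x]]) simp

lemma avg_diff:
  assumes "set_integrable lborel \<Omega> v" "set_integrable lborel \<Omega> w" "x \<in> \<Omega>"
  shows "avg (\<lambda>x. v x - w x) x = avg v x - avg w x"
  unfolding avg_def using assms by (simp add: set_integrable_win set_integral_diff diff_divide_distrib)

lemma avg_add:
  assumes "set_integrable lborel \<Omega> v" "set_integrable lborel \<Omega> w" "x \<in> \<Omega>"
  shows "avg (\<lambda>x. v x + w x) x = avg v x + avg w x"
  unfolding avg_def using assms by (simp add: set_integrable_win set_integral_add add_divide_distrib)

lemma avg_mono:
  assumes "set_integrable lborel \<Omega> v" "set_integrable lborel \<Omega> w" "x \<in> \<Omega>" "\<And>y. y \<in> \<Omega> \<Longrightarrow> v y \<le> w y"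
  shows "avg v x \<le> avg w x"
  unfolding avg_def using assms win_subset[of x] len_pos
  by (intro divide_right_mono set_integral_mono set_integrable_win) auto

lemma abs_avg_le:
  assumes "set_integrable lborel \<Omega> v" "x \<in> \<Omega>"
  shows "\<bar>avg v x\<bar> \<le> avg (\<lambda>y. \<bar>v y\<bar>) x"
proof -
  have v: "set_integrable lborel \<Omega> (\<lambda>y. \<bar>v y\<bar>)" "set_integrable lborel \<Omega> (\<lambda>y. - v y)"
    using assms(1) set_integrable_abs by (auto simp: set_integrable_def)
  have "avg v x \<le> avg (\<lambda>y. \<bar>v y\<bar>) x"
    using assms v by (intro avg_mono) auto
  moreover have "avg (\<lambda>y. - v y) x \<le> avg (\<lambda>y. \<bar>v y\<bar>) x"
    using assms v by (intro avg_mono) auto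
  moreover have "avg (\<lambda>y. - v y) x = - avg v x"
    by (simp add: avg_def set_lebesgue_integral_def)
  ultimately show ?thesis by linarith
qed

section \<open>Jensen's inequality and the L^2 bound\<close>

lemma avg_const: "avg (\<lambda>_. c) x = c"
  using emeasure_win[of x] measure_win[of x] len_pos by (simp add: avg_def set_lebesgue_integral_def)

text \<open>Jensen's inequality for the square: the tangent inequality 2 m h <= h^2 + m^2 is
  averaged with m equal to the mean of h.\<close>

lemma avg_sq_le:
  assumes h: "set_integrable lborel \<Omega> h" and h2: "set_integrable lborel \<Omega> (\<lambda>x. (h x)\<^sup>2)" and x: "x \<in> \<Omega>"
  shows "(avg h x)\<^sup>2 \<le> avg (\<lambda>x. (h x)\<^sup>2) x"
proof -
  define m where "m = avg h x"
  have c: "set_integrable lborel \<Omega> (\<lambda>_. m\<^sup>2)" by (rule set_integrable_continuous) simp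
  have hm: "set_integrable lborel \<Omega> (\<lambda>y. 2 * m * h y)" using h by (intro set_integrable_mult_right) auto
  have "avg (\<lambda>y. 2 * m * h y) x \<le> avg (\<lambda>y. (h y)\<^sup>2 + m\<^sup>2) x"
  proof (rule avg_mono[OF hm _ x])
    show "2 * m * h y \<le> (h y)\<^sup>2 + m\<^sup>2" for y
      using sum_squares_bound[of "h y" m] by (simp add: ac_simps)
  qed (rule set_integral_add(1)[OF h2 c])
  also have "\<dots> = avg (\<lambda>y. (h y)\<^sup>2) x + m\<^sup>2"
    by (simp add: avg_add[OF h2 c x] avg_const)
  also have "avg (\<lambda>y. 2 * m * h y) x = 2 * m * avg h x"
    by (simp add: avg_def)
  finally show ?thesis by (simp add: m_def power2_eq_square)
qed

lemma avg_measurable: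
  assumes "h \<in> borel_measurable borel"
  shows "avg h \<in> borel_measurable borel"
proof -
  have [measurable]: "h \<in> borel_measurable lborel" using assms by simp
  show ?thesis unfolding avg_def[abs_def] set_lebesgue_integral_def win_def indicator_def atLeastAtMost_iff by measurable
qed

text \<open>Of the two factors 1 - \<theta> produced by squaring, one is discarded and the other
  absorbs the gain of \<open>avg_integral_le\<close>. Hence the constant is exactly 1.\<close>

lemma avg_L2:
  assumes m: "h \<in> borel_measurable borel"
    and h: "set_integrable lborel \<Omega> h" and h2: "set_integrable lborel \<Omega> (\<lambda>x. (h x)\<^sup>2)"
  shows avg_L2_integrable: "set_integrable lborel \<Omega> (\<lambda>x. ((1 - \<theta>) * avg h x)\<^sup>2)"
    and avg_L2_le: "(LINT x:\<Omega>|lborel. ((1 - \<theta>) * avg h x)\<^sup>2) \<le> (LINT x:\<Omega>|lborel. (h x)\<^sup>2)"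
proof -
  note [measurable] = avg_measurable[OF m]
  have le: "((1 - \<theta>) * avg h x)\<^sup>2 \<le> (1 - \<theta>) * avg (\<lambda>x. (h x)\<^sup>2) x" if "x \<in> \<Omega>" for x
  proof -
    have "(1 - \<theta>)\<^sup>2 * (avg h x)\<^sup>2 \<le> (1 - \<theta>) * avg (\<lambda>x. (h x)\<^sup>2) x"
      using th avg_sq_le[OF h h2 that] by (intro mult_mono) (auto simp: power2_eq_square mult_left_le)
    then show ?thesis by (simp add: power_mult_distrib)
  qed
  have i: "set_integrable lborel \<Omega> (\<lambda>x. (1 - \<theta>) * avg (\<lambda>x. (h x)\<^sup>2) x)"
    using set_integrable_avg[OF h2] by (intro set_integrable_mult_right) auto
  show i2: "set_integrable lborel \<Omega> (\<lambda>x. ((1 - \<theta>) * avg h x)\<^sup>2)"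
  proof (rule set_integrable_bound[OF i])
    show "set_borel_measurable lborel \<Omega> (\<lambda>x. ((1 - \<theta>) * avg h x)\<^sup>2)"
      unfolding set_borel_measurable_def by measurable
    show "AE x in lborel. x \<in> \<Omega> \<longrightarrow> norm (((1 - \<theta>) * avg h x)\<^sup>2) \<le> norm ((1 - \<theta>) * avg (\<lambda>x. (h x)\<^sup>2) x)"
      using le by (auto intro!: AE_I2 order_trans[OF _ abs_ge_self])
  qed
  have "(LINT x:\<Omega>|lborel. ((1 - \<theta>) * avg h x)\<^sup>2) \<le> (LINT x:\<Omega>|lborel. (1 - \<theta>) * avg (\<lambda>x. (h x)\<^sup>2) x)"
    using le by (intro set_integral_mono i i2) auto
  also have "\<dots> \<le> (LINT x:\<Omega>|lborel. (h x)\<^sup>2)"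
    using avg_integral_le[OF h2] by simp
  finally show "(LINT x:\<Omega>|lborel. ((1 - \<theta>) * avg h x)\<^sup>2) \<le> (LINT x:\<Omega>|lborel. (h x)\<^sup>2)" .
qed

section \<open>The L^1 error of averaging\<close>

lemma avg_error_integrable:
  assumes "set_integrable lborel \<Omega> v"
  shows "set_integrable lborel \<Omega> (\<lambda>x. \<bar>avg v x - v x\<bar>)"
  using set_integral_diff(1)[OF set_integrable_avg[OF assms] assms] by (rule set_integrable_abs)

text \<open>The constant 3 is 1 for v - w itself plus 2 >= 1 / (1 - \<theta>) for its average. Being
  uniform in \<theta> <= 1/2, it makes the functions with vanishing error closed under L^1
  limits.\<close>

lemma avg_error_perturb:
  assumes v: "set_integrable lborel \<Omega> v" and w: "set_integrable lborel \<Omega> w" and th2: "\<theta> \<le> 1 / 2"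
  shows "(LINT x:\<Omega>|lborel. \<bar>avg v x - v x\<bar>) \<le> (LINT x:\<Omega>|lborel. \<bar>avg w x - w x\<bar>) + 3 * (LINT x:\<Omega>|lborel. \<bar>v x - w x\<bar>)"
proof -
  let ?d = "\<lambda>x. \<bar>v x - w x\<bar>"
  have d0: "set_integrable lborel \<Omega> (\<lambda>x. v x - w x)" using v w by (rule set_integral_diff)
  then have d: "set_integrable lborel \<Omega> ?d" by (rule set_integrable_abs)
  have "(LINT x:\<Omega>|lborel. \<bar>avg v x - v x\<bar>) \<le> (LINT x:\<Omega>|lborel. \<bar>avg w x - w x\<bar> + (avg ?d x + ?d x))"
  proof (intro set_integral_mono set_integral_add avg_error_integrable v w d set_integrable_avg)
    fix x assume x: "x \<in> \<Omega>"
    show "\<bar>avg v x - v x\<bar> \<le> \<bar>avg w x - w x\<bar> + (avg ?d x + ?d x)"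
      using abs_avg_le[OF d0 x] avg_diff[OF v w x] by linarith
  qed
  also have "\<dots> = (LINT x:\<Omega>|lborel. \<bar>avg w x - w x\<bar>) + ((LINT x:\<Omega>|lborel. avg ?d x) + (LINT x:\<Omega>|lborel. ?d x))"
    using avg_error_integrable[OF w] set_integrable_avg[OF d] d
    by (simp add: set_integral_add)
  also have "(LINT x:\<Omega>|lborel. avg ?d x) \<le> 2 * (LINT x:\<Omega>|lborel. ?d x)"
  proof -
    have "0 \<le> (LINT x:\<Omega>|lborel. avg ?d x)"
      unfolding set_lebesgue_integral_def
      using abs_avg_le[OF d0] by (intro integral_nonneg_AE AE_I2) (auto simp: indicator_def intro: order_trans[OF abs_ge_zero])
    then have "1 / 2 * (LINT x:\<Omega>|lborel. avg ?d x) \<le> (1 - \<theta>) * (LINT x:\<Omega>|lborel. avg ?d x)"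
      using th2 by (intro mult_right_mono) auto
    then show ?thesis using avg_integral_le[OF d] by simp
  qed
  finally show ?thesis by simp
qed

lemma avg_error_add:
  assumes v: "set_integrable lborel \<Omega> v" and w: "set_integrable lborel \<Omega> w"
  shows "(LINT x:\<Omega>|lborel. \<bar>avg (\<lambda>x. v x + w x) x - (v x + w x)\<bar>)
    \<le> (LINT x:\<Omega>|lborel. \<bar>avg v x - v x\<bar>) + (LINT x:\<Omega>|lborel. \<bar>avg w x - w x\<bar>)"
proof -
  have "(LINT x:\<Omega>|lborel. \<bar>avg (\<lambda>x. v x + w x) x - (v x + w x)\<bar>)
    \<le> (LINT x:\<Omega>|lborel. \<bar>avg v x - v x\<bar> + \<bar>avg w x - w x\<bar>)"
    using v w by (intro set_integral_mono set_integral_add avg_error_integrable) (auto simp: avg_add)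
  then show ?thesis
    using avg_error_integrable[OF v] avg_error_integrable[OF w] by (simp add: set_integral_add)
qed

text \<open>Since averaging hardly increases the integral, mass appearing outside \<open>U\<close> is controlled by mass lost
  inside \<open>U\<close>; for open \<open>U\<close> the latter vanishes in the limit, whatever the measure of the boundary of \<open>U\<close>.\<close>

lemma avg_error_indicator:
  assumes [measurable]: "U \<in> sets borel"
  defines "v \<equiv> indicator U :: real \<Rightarrow> real"
  shows "(LINT x:\<Omega>|lborel. \<bar>avg v x - v x\<bar>)
    \<le> 2 * (LINT x:\<Omega>|lborel. v x * (1 - avg v x)) + (1 / (1 - \<theta>) - 1) * (LINT x:\<Omega>|lborel. v x)"
    and "x \<in> \<Omega> \<Longrightarrow> avg v x \<in> {0..1}"
    and "set_integrable lborel \<Omega> (\<lambda>x. v x * (1 - avg v x))"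
proof -
  have c: "set_integrable lborel \<Omega> (\<lambda>_. k)" for k :: real by (rule set_integrable_continuous) simp
  have v: "set_integrable lborel \<Omega> v"
    by (rule set_integrable_bound[OF c[of 1]]) (auto simp: set_borel_measurable_def v_def indicator_def)
  show b: "avg v x \<in> {0..1}" if "x \<in> \<Omega>" for x
    using avg_mono[OF v c[of 1] that] avg_mono[OF c[of 0] v that] by (simp add: avg_const v_def)
  have va: "set_integrable lborel \<Omega> (avg v)" by (rule set_integrable_avg[OF v])
  show p: "set_integrable lborel \<Omega> (\<lambda>x. v x * (1 - avg v x))"
  proof -
    have "set_integrable lborel \<Omega> (\<lambda>x. 1 - avg v x)" using c[of 1] va by (rule set_integral_diff)
    then have "integrable lborel (\<lambda>x. indicator U x *\<^sub>R (indicator \<Omega> x *\<^sub>R (1 - avg v x)))"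
      unfolding set_integrable_def by (rule integrable_mult_indicator[rotated]) simp
    then show ?thesis unfolding set_integrable_def v_def by (simp add: ac_simps)
  qed
  \<comment> \<open>The integrands agree pointwise: v is 0 or 1 and the mean lies in [0, 1], and
    both cases are checked directly.\<close>
  have "(LINT x:\<Omega>|lborel. \<bar>avg v x - v x\<bar>) = (LINT x:\<Omega>|lborel. 2 * (v x * (1 - avg v x)) + (avg v x - v x))"
    using b by (intro set_lebesgue_integral_cong) (auto simp: v_def indicator_def)
  also have "\<dots> = 2 * (LINT x:\<Omega>|lborel. v x * (1 - avg v x)) + ((LINT x:\<Omega>|lborel. avg v x) - (LINT x:\<Omega>|lborel. v x))"
    using p v va by (simp add: set_integral_add set_integral_diff)
  also have "(LINT x:\<Omega>|lborel. avg v x) \<le> (LINT x:\<Omega>|lborel. v x) / (1 - \<theta>)"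
    using avg_integral_le[OF v] th by (simp add: v_def field_simps)
  finally show "(LINT x:\<Omega>|lborel. \<bar>avg v x - v x\<bar>)
    \<le> 2 * (LINT x:\<Omega>|lborel. v x * (1 - avg v x)) + (1 / (1 - \<theta>) - 1) * (LINT x:\<Omega>|lborel. v x)"
    by (simp add: algebra_simps)
qed

lemma avg_indicator_eq_1:
  assumes "x \<in> \<Omega>" "\<And>y. \<bar>x - y\<bar> \<le> len \<Longrightarrow> y \<in> U"
  shows "avg (indicator U) x = 1"
proof -
  have "avg (indicator U) x = avg (\<lambda>_. 1) x"
    unfolding avg_def using dist_win[of x] assms
    by (intro arg_cong2[where f="(/)"] set_lebesgue_integral_cong) (auto simp: indicator_def)
  then show ?thesis by (simp add: avg_const)
qed

lemma avg_scale: "avg (\<lambda>x. c * v x) x = c * avg v x"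
  by (simp add: avg_def)

end

text \<open>The class of functions with vanishing error grows from indicators of open sets, by outer
  regularity to Borel sets of finite measure, by additivity to simple functions, and by closedness
  to L^1. Pointwise convergence of the means is used only at points of an open set, where the window
  eventually lies inside it.\<close>

lemma avg_tendsto_L1:
  fixes u :: "real \<Rightarrow> real"
  assumes ab: "a < b" and u: "set_integrable lborel {a<..<b} u"
    and t: "\<And>n. 0 < t n" "\<And>n. t n \<le> 1 / 2" "t \<longlonglongrightarrow> 0"
  shows "(\<lambda>n. LINT x:{a<..<b}|lborel. \<bar>window.avg a b (t n) u x - u x\<bar>) \<longlonglongrightarrow> 0"
proof -
  let ?\<Omega> = "{a<..<b}"
  define D where "D n v = (LINT x:?\<Omega>|lborel. \<bar>window.avg a b (t n) v x - v x\<bar>)" for n v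
  have win: "window a b (t n)" for n
    using ab t(1,2)[of n] by unfold_locales auto
  have si: "set_integrable lborel ?\<Omega> v" if "integrable lborel v" for v :: "real \<Rightarrow> real"
    unfolding set_integrable_def using that by (rule integrable_mult_indicator[rotated]) simp
  have D0: "0 \<le> D n v" for n v
    unfolding D_def set_lebesgue_integral_def by (intro integral_nonneg_AE AE_I2) auto
  have pert: "D n v \<le> D n w + 3 * (LINT x:?\<Omega>|lborel. \<bar>v x - w x\<bar>)"
    if "set_integrable lborel ?\<Omega> v" "set_integrable lborel ?\<Omega> w" for n v w
    unfolding D_def using window.avg_error_perturb[OF win that t(2)] .
  \<comment> \<open>Closedness in L^1: an approximation within r / 6 costs r / 2 by the factor 3,
    and the other r / 2 is the error of w for large n.\<close>
  have closure: "(\<lambda>n. D n v) \<longlonglongrightarrow> 0"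
    if v: "integrable lborel v"
      and ex: "\<And>e. 0 < e \<Longrightarrow> \<exists>w. integrable lborel w \<and> (\<lambda>n. D n w) \<longlonglongrightarrow> 0 \<and> (\<integral>x. \<bar>v x - w x\<bar> \<partial>lborel) < e" for v
  proof (rule LIMSEQ_I)
    fix r :: real assume r: "0 < r"
    then obtain w where w: "integrable lborel w" "(\<lambda>n. D n w) \<longlonglongrightarrow> 0" "(\<integral>x. \<bar>v x - w x\<bar> \<partial>lborel) < r / 6"
      using ex[of "r / 6"] by auto
    have "(LINT x:?\<Omega>|lborel. \<bar>v x - w x\<bar>) \<le> (\<integral>x. \<bar>v x - w x\<bar> \<partial>lborel)"
      unfolding set_lebesgue_integral_def using v w(1)
      by (intro integral_mono' integrable_abs Bochner_Integration.integrable_diff) (auto simp: indicator_def)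
    then have *: "D n v \<le> D n w + r / 2" for n
      using pert[OF si[OF v] si[OF w(1)], of n] w(3) by linarith
    obtain N where "\<And>n. n \<ge> N \<Longrightarrow> norm (D n w - 0) < r / 2"
      using LIMSEQ_D[OF w(2), of "r / 2"] r by auto
    then have "norm (D n v - 0) < r" if "n \<ge> N" for n
      using *[of n] D0[of n v] D0[of n w] that by fastforce
    then show "\<exists>N. \<forall>n\<ge>N. norm (D n v - 0) < r" by blast
  qed
  have op: "(\<lambda>n. D n (indicator U)) \<longlonglongrightarrow> 0" if U: "open U" for U
  proof -
    have [measurable]: "U \<in> sets borel" using U by simp
    let ?v = "indicator U :: real \<Rightarrow> real"
    let ?A = "\<lambda>n x. window.avg a b (t n) ?v x"
    have "(\<lambda>n. LINT x:?\<Omega>|lborel. ?v x * (1 - ?A n x)) \<longlonglongrightarrow> (\<integral>x. 0 \<partial>(lborel :: real measure))"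
      unfolding set_lebesgue_integral_def
    proof (rule integral_dominated_convergence)
      show "integrable lborel (\<lambda>x. indicator ?\<Omega> x :: real)" using ab by simp
      show "(\<lambda>x. indicator ?\<Omega> x *\<^sub>R (?v x * (1 - ?A n x))) \<in> borel_measurable lborel" for n
        using window.avg_error_indicator(3)[OF win, of U n] by (simp add: set_integrable_def)
      show "AE x in lborel. norm (indicator ?\<Omega> x *\<^sub>R (?v x * (1 - ?A n x))) \<le> indicator ?\<Omega> x" for n
        using window.avg_error_indicator(2)[OF win, of U _ n] by (intro AE_I2) (auto simp: indicator_def)
      have "(\<lambda>n. indicator ?\<Omega> x *\<^sub>R (?v x * (1 - ?A n x))) \<longlonglongrightarrow> 0" for x
      proof (cases "x \<in> ?\<Omega> \<and> x \<in> U")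
        case True
        then obtain e where e: "0 < e" "ball x e \<subseteq> U" using U open_contains_ball by blast
        have "(\<lambda>n. t n * (b - a)) \<longlonglongrightarrow> 0 * (b - a)" by (intro tendsto_intros t)
        then have "eventually (\<lambda>n. t n * (b - a) < e) sequentially"
          using e by (auto dest!: order_tendstoD(2))
        then have "eventually (\<lambda>n. ?A n x = 1) sequentially"
        proof eventually_elim
          case (elim n)
          show ?case
          proof (rule window.avg_indicator_eq_1[OF win])
            fix y assume "\<bar>x - y\<bar> \<le> window.len a b (t n)"
            then have "y \<in> ball x e" using elim by (simp add: window.len_def[OF win] dist_real_def)
            then show "y \<in> U" using e by blast
          qed (use True in simp)
        qed
        then have "eventually (\<lambda>n. indicator ?\<Omega> x *\<^sub>R (?v x * (1 - ?A n x)) = 0) sequentially"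
          by eventually_elim simp
        then show ?thesis by (rule tendsto_eventually)
      next
        case False
        then have "(\<lambda>n. indicator ?\<Omega> x *\<^sub>R (?v x * (1 - ?A n x))) = (\<lambda>n. 0)"
          by (auto simp: indicator_def)
        then show ?thesis by simp
      qed
      then show "AE x in lborel. (\<lambda>n. indicator ?\<Omega> x *\<^sub>R (?v x * (1 - ?A n x))) \<longlonglongrightarrow> 0" by simp
    qed simp
    then have "(\<lambda>n. 2 * (LINT x:?\<Omega>|lborel. ?v x * (1 - ?A n x)) + (1 / (1 - t n) - 1) * (LINT x:?\<Omega>|lborel. ?v x))
        \<longlonglongrightarrow> 2 * (\<integral>x. 0 \<partial>(lborel :: real measure)) + (1 / (1 - 0) - 1) * (LINT x:?\<Omega>|lborel. ?v x)"
      by (intro tendsto_intros t) auto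
    then have lim: "(\<lambda>n. 2 * (LINT x:?\<Omega>|lborel. ?v x * (1 - ?A n x)) + (1 / (1 - t n) - 1) * (LINT x:?\<Omega>|lborel. ?v x)) \<longlonglongrightarrow> 0"
      by simp
    show ?thesis
    proof (rule tendsto_sandwich[OF _ _ tendsto_const lim])
      show "eventually (\<lambda>n. D n ?v \<le> 2 * (LINT x:?\<Omega>|lborel. ?v x * (1 - ?A n x)) + (1 / (1 - t n) - 1) * (LINT x:?\<Omega>|lborel. ?v x)) sequentially"
        unfolding D_def using window.avg_error_indicator(1)[OF win, of U] by simp
    qed (simp add: D0)
  qed
  have scale: "D n (\<lambda>x. v x *\<^sub>R c) = \<bar>c\<bar> * D n v" for n v and c :: real
  proof -
    have "\<bar>window.avg a b (t n) (\<lambda>x. v x *\<^sub>R c) x - v x *\<^sub>R c\<bar> = \<bar>c\<bar> * \<bar>window.avg a b (t n) v x - v x\<bar>" for x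
    proof -
      have "window.avg a b (t n) (\<lambda>x. v x *\<^sub>R c) x = c * window.avg a b (t n) v x"
        using window.avg_scale[OF win, of n c v x] by (simp add: mult.commute)
      then show ?thesis by (simp add: abs_mult[symmetric] algebra_simps)
    qed
    then show ?thesis unfolding D_def by simp
  qed
  have main: "(\<lambda>n. D n v) \<longlonglongrightarrow> 0" if "integrable lborel v" for v
    using that
  proof (induction rule: integrable_induct)
    case (base A c)
    then have A: "A \<in> sets borel" by simp
    show ?case
    proof (rule closure)
      show "integrable lborel (\<lambda>x. indicator A x *\<^sub>R c)" using base by auto
      fix e :: real assume e: "0 < e"
      \<comment> \<open>The added 1 covers c = 0 and makes the final inequality strict.\<close>
      define e' where "e' = e / (\<bar>c\<bar> + 1)"
      have e': "0 < e'" "\<bar>c\<bar> * e' < e" using e by (auto simp: e'_def field_simps)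
      obtain U where U: "open U" "A \<subseteq> U" "emeasure lborel (U - A) < ennreal e'"
        using outer_regular_lborel[OF A e'(1)] by blast
      have [measurable]: "U \<in> sets borel" "A \<in> sets borel" using U A by auto
      have "emeasure lborel U = emeasure lborel A + emeasure lborel (U - A)"
        using U(2) by (subst plus_emeasure) (auto simp: Un_absorb1)
      also have "\<dots> < \<infinity>" using base(2) less_trans[OF U(3) ennreal_less_top] by simp
      finally have Ui: "integrable lborel (\<lambda>x. indicator U x *\<^sub>R c)" by auto
      have "(\<integral>x. \<bar>indicator A x *\<^sub>R c - indicator U x *\<^sub>R c\<bar> \<partial>lborel) = (\<integral>x. indicator (U - A) x * \<bar>c\<bar> \<partial>lborel)"
        using U(2) by (intro Bochner_Integration.integral_cong) (auto simp: indicator_def)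
      also have "\<dots> = measure lborel (U - A) * \<bar>c\<bar>" by simp
      also have "\<dots> \<le> \<bar>c\<bar> * e'"
        using U(3) e' by (subst mult.commute, intro mult_left_mono) (auto simp: measure_def enn2real_leI less_imp_le)
      also have "\<dots> < e" by (rule e')
      finally have "(\<integral>x. \<bar>indicator A x *\<^sub>R c - indicator U x *\<^sub>R c\<bar> \<partial>lborel) < e" .
      moreover have "(\<lambda>n. D n (\<lambda>x. indicator U x *\<^sub>R c)) \<longlonglongrightarrow> 0"
        unfolding scale using tendsto_mult_left[OF op[OF U(1)], of "\<bar>c\<bar>"] by simp
      ultimately show "\<exists>w. integrable lborel w \<and> (\<lambda>n. D n w) \<longlonglongrightarrow> 0 \<and>
          (\<integral>x. \<bar>indicator A x *\<^sub>R c - w x\<bar> \<partial>lborel) < e"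
        using Ui by blast
    qed
  next
    case (add f g)
    show ?case
    proof (rule tendsto_sandwich[OF _ _ tendsto_const])
      show "(\<lambda>n. D n f + D n g) \<longlonglongrightarrow> 0" using tendsto_add[OF add.IH] by simp
      show "eventually (\<lambda>n. D n (\<lambda>x. f x + g x) \<le> D n f + D n g) sequentially"
        unfolding D_def using window.avg_error_add[OF win si[OF add.hyps(1)] si[OF add.hyps(2)]] by simp
    qed (simp add: D0)
  next
    case (lim f s)
    show ?case
    proof (rule closure[OF lim.hyps(4)])
      fix e :: real assume e: "0 < e"
      have "(\<lambda>i. \<integral>x. \<bar>f x - s i x\<bar> \<partial>lborel) \<longlonglongrightarrow> (\<integral>x. 0 \<partial>(lborel :: real measure))"
      proof (rule integral_dominated_convergence)
        \<comment> \<open>The approximants supplied by \<open>integrable_induct\<close> satisfy |s i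
          x| <= 2 |f x|, hence the majorant 3 |f|.\<close>
        show "integrable lborel (\<lambda>x. 3 * \<bar>f x\<bar>)" using lim.hyps(4) by simp
        show "(\<lambda>x. \<bar>f x - s i x\<bar>) \<in> borel_measurable lborel" for i
          using lim.hyps(1)[of i] lim.hyps(4) by (auto dest!: borel_measurable_integrable)
        have "(\<lambda>i. \<bar>f x - s i x\<bar>) \<longlonglongrightarrow> \<bar>f x - f x\<bar>" for x
          using lim.hyps(2)[of x] by (intro tendsto_intros) auto
        then show "AE x in lborel. (\<lambda>i. \<bar>f x - s i x\<bar>) \<longlonglongrightarrow> 0" by simp
        have "norm \<bar>f x - s i x\<bar> \<le> 3 * \<bar>f x\<bar>" for i x
          using lim.hyps(3)[of x i] by auto
        then show "AE x in lborel. norm \<bar>f x - s i x\<bar> \<le> 3 * \<bar>f x\<bar>" for i by simp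
      qed simp
      then have "eventually (\<lambda>i. (\<integral>x. \<bar>f x - s i x\<bar> \<partial>lborel) < e) sequentially"
        using e by (intro order_tendstoD(2)) auto
      then obtain i where "(\<integral>x. \<bar>f x - s i x\<bar> \<partial>lborel) < e" using eventually_happens by force
      then show "\<exists>w. integrable lborel w \<and> (\<lambda>n. D n w) \<longlonglongrightarrow> 0 \<and> (\<integral>x. \<bar>f x - w x\<bar> \<partial>lborel) < e"
        using lim.hyps(1) lim.IH by blast
    qed
  qed
  define v where "v x = indicator ?\<Omega> x * u x" for x
  have v: "integrable lborel v" using u by (simp add: set_integrable_def v_def[abs_def])
  have "(LINT x:?\<Omega>|lborel. \<bar>u x - v x\<bar>) = (LINT x:?\<Omega>|lborel. 0)"
    by (intro set_lebesgue_integral_cong) (auto simp: v_def)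
  then have "D n u \<le> D n v" for n using pert[OF u si[OF v], of n] by simp
  then have "(\<lambda>n. D n u) \<longlonglongrightarrow> 0"
    by (intro tendsto_sandwich[OF _ _ tendsto_const main[OF v]]) (auto simp: D0)
  then show ?thesis by (simp add: D_def)
qed

section \<open>The nonlocal energy\<close>

context window
begin

text \<open>Within distance \<open>\<epsilon> + len\<close> of \<open>B\<close> the cost is estimated by its saturation value \<open>c0\<close>, elsewhere by its
  linear bound. Truncated intervals near \<open>a\<close> and \<open>b\<close> are shorter than \<open>2 \<epsilon>\<close>, so the averages
  count the mass of the boundary layer up to twice.\<close>

lemma nonlocal_energy_le:
  assumes rep: "sm_rep a b \<gamma> P N"
    and g: "\<And>x. x \<in> \<Omega> \<Longrightarrow> g x = kap * \<gamma> (W x)"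
    and B: "finite B" and c0: "0 < c0" and eps: "0 < \<epsilon>" "\<epsilon> < b - a" "len \<le> \<epsilon>"
  defines "V \<equiv> \<lambda>A. measure P A + measure N A"
  shows "(LINT x:\<Omega>|lborel. f_cost c0 (\<epsilon> * avg_abs a b \<epsilon> g x))
    \<le> c0 * (card B * (2 * (\<epsilon> + len))) + c0 * \<epsilon> * (V (\<Omega> - B) + V (\<Omega> - {a + 3 * \<epsilon>..b - 3 * \<epsilon>}))"
proof -
  note r = sm_repD[OF rep]
  define Q where "Q = plus_measure P N"
  have Q: "finite_measure Q" "sets Q = sets (restrict_space borel \<Omega>)"
    using r by (auto simp: Q_def intro!: finite_measure_plus_measure)
  interpret Q: finite_measure Q by (fact Q(1))
  have spQ: "space Q = \<Omega>" using sets_eq_imp_space_eq[OF Q(2)] by (simp add: space_restrict_space)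
  have id [measurable]: "(\<lambda>y. y) \<in> borel_measurable Q"
    unfolding measurable_cong_sets[OF Q(2) refl] by (intro measurable_restrict_space1) simp
  have setQ: "A \<in> sets Q \<longleftrightarrow> A \<in> sets borel \<and> A \<subseteq> \<Omega>" for A
    using Q(2) by (simp add: sets_restrict_Ioo_iff)
  have QV: "measure Q A = V A" if "A \<in> sets borel" "A \<subseteq> \<Omega>" for A
    using that r(1,2,6,7) by (simp add: Q_def V_def measure_plus_measure sets_restrict_Ioo_iff)
  have Bb [measurable]: "B \<in> sets borel" using B by (rule finite_imp_closed[THEN borel_closed])
  have mB: "(\<lambda>y. indicator (- B) y :: real) \<in> borel_measurable Q"
    unfolding measurable_cong_sets[OF Q(2) refl] by (intro measurable_restrict_space1) simp
  \<comment> \<open>G samples the mass outside B only. It dominates |g| at every t whose window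
    misses B, and elsewhere no comparison is made.\<close>
  define G where "G t = kap * (\<integral>y. indicator (W t) y * indicator (- B) y \<partial>Q)" for t
  have vB: "integrable Q (indicator (- B) :: real \<Rightarrow> real)"
    by (rule Q.integrable_const_bound[where B = 1]) (auto intro!: mB)
  have Gpos: "0 \<le> G t" for t
    unfolding G_def using kap_pos by (intro mult_nonneg_nonneg integral_nonneg_AE AE_I2) auto
  have gG: "\<bar>g t\<bar> \<le> G t" if t: "t \<in> \<Omega>" "W t \<inter> B = {}" for t
  proof -
    have "(\<integral>y. indicator (W t) y * indicator (- B) y \<partial>Q) = (\<integral>y. (indicator (W t) y :: real) \<partial>Q)"
      using t(2) by (intro Bochner_Integration.integral_cong) (auto simp: indicator_def)
    also have "\<dots> = V (W t)"
      using win_subset[OF t(1)] by (simp add: spQ Int_absorb2 QV)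
    finally have "G t = kap * V (W t)" by (simp add: G_def)
    moreover have "\<bar>\<gamma> (W t)\<bar> \<le> V (W t)"
      using r(8)[OF win_borel win_subset[OF t(1)]] by (simp add: V_def abs_le_iff)
    ultimately show ?thesis using kap_pos by (simp add: g[OF t(1)] abs_mult)
  qed
  have Gi: "integrable lborel (\<lambda>t. indicator \<Omega> t * G t)"
  proof -
    have "integrable lborel (\<lambda>t. kap * (indicator \<Omega> t * (\<integral>y. indicator (W t) y * indicator (- B) y \<partial>Q)))"
      using vB by (intro integrable_mult_right win_Fubini_integrable1 Q.sigma_finite_measure_axioms id integrable_indicator_Omega)
    then show ?thesis by (simp add: G_def ac_simps)
  qed
  \<comment> \<open>For x in (a, b) and \<epsilon> < b - a the truncated interval has length at
    least \<epsilon>, so the maximum changes nothing there. For all other x it keeps the kernel k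
    bounded by 1 / \<epsilon>.\<close>
  define m where "m x = max \<epsilon> (min (x + \<epsilon>) b - max (x - \<epsilon>) a)" for x
  have m_pos: "\<epsilon> \<le> m x" for x by (simp add: m_def)
  have m_eq: "measure lborel ({x - \<epsilon><..<x + \<epsilon>} \<inter> \<Omega>) = m x" if x: "x \<in> \<Omega>" for x
  proof -
    have le: "\<epsilon> \<le> min (x + \<epsilon>) b - max (x - \<epsilon>) a" using x eps by auto
    have "{x - \<epsilon><..<x + \<epsilon>} \<inter> \<Omega> = {max (x - \<epsilon>) a<..<min (x + \<epsilon>) b}" by auto
    moreover have "max (x - \<epsilon>) a \<le> min (x + \<epsilon>) b" using le eps by linarith
    ultimately show ?thesis using le by (simp only: measure_lborel_Ioo m_def max_absorb2)
  qed
  define k :: "real \<Rightarrow> real \<Rightarrow> real" where "k x t = (if \<bar>x - t\<bar> < \<epsilon> then 1 else 0) / m x" for x t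
  have km: "(\<lambda>(x, t). k x t) \<in> borel_measurable (lborel \<Otimes>\<^sub>M lborel)"
    unfolding k_def m_def by measurable
  have k_pos: "0 \<le> k x t" for x t using m_pos[of x] eps by (auto simp: k_def)
  have k_le: "k x t \<le> (1 / \<epsilon>) * indicator {t - \<epsilon><..<t + \<epsilon>} x" for x t
    using m_pos[of x] eps by (auto simp: k_def indicator_def frac_le)
  have kb: "\<bar>k x t\<bar> \<le> 1 / \<epsilon>" for x t
    using k_le[of x t] k_pos[of x t] eps by (auto simp: indicator_def split: if_splits intro: order_trans)
  define A where "A x = (\<integral>t. k x t * (indicator \<Omega> t * G t) \<partial>lborel)" for x
  \<comment> \<open>The weight that a point t receives from all nonlocal averages together. It is at
    most 2, and at most 1 at distance 2 \<epsilon> from the boundary, where every interval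
    containing t has full length 2 \<epsilon>.\<close>
  define w where "w t = (\<integral>x. k x t * indicator \<Omega> x \<partial>lborel)" for t
  note FA = kernel_Fubini[OF lborel.sigma_finite_measure_axioms lborel.sigma_finite_measure_axioms
      integrable_indicator_Omega Gi km kb, folded A_def w_def]
  have A_pos: "0 \<le> A x" for x
    unfolding A_def using k_pos Gpos by (intro integral_nonneg_AE AE_I2) auto
  have w_pos: "0 \<le> w t" for t
    unfolding w_def using k_pos by (intro integral_nonneg_AE AE_I2) auto
  have Ii: "integrable lborel (\<lambda>x. c * indicator {t - \<epsilon><..<t + \<epsilon>} x)"
    "(\<integral>x. c * indicator {t - \<epsilon><..<t + \<epsilon>} x \<partial>lborel) = c * (2 * \<epsilon>)" for c t :: real
    using eps by auto
  have kI: "k x t * indicator \<Omega> x \<le> k x t" for x t using k_pos[of x t] by (simp add: indicator_def)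
  have w_le2: "w t \<le> 2" for t
  proof -
    have "w t \<le> (\<integral>x. (1 / \<epsilon>) * indicator {t - \<epsilon><..<t + \<epsilon>} x \<partial>lborel)"
      unfolding w_def using order_trans[OF kI k_le] eps by (intro integral_mono' Ii) auto
    then show ?thesis unfolding Ii(2) using eps by simp
  qed
  have w_le1: "w t \<le> 1" if t: "t \<in> {a + 2 * \<epsilon>..b - 2 * \<epsilon>}" for t
  proof -
    have "k x t \<le> (1 / (2 * \<epsilon>)) * indicator {t - \<epsilon><..<t + \<epsilon>} x" for x
      using t eps by (auto simp: k_def m_def indicator_def)
    then have "w t \<le> (\<integral>x. (1 / (2 * \<epsilon>)) * indicator {t - \<epsilon><..<t + \<epsilon>} x \<partial>lborel)"
      unfolding w_def using order_trans[OF kI] eps by (intro integral_mono' Ii) auto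
    then show ?thesis unfolding Ii(2) using eps by simp
  qed
  have w_m [measurable]: "w \<in> borel_measurable borel"
  proof -
    have "(\<lambda>t. \<integral>x. k x t * indicator \<Omega> x \<partial>lborel) \<in> borel_measurable lborel"
      unfolding k_def m_def by measurable
    then show ?thesis by (simp add: w_def[abs_def])
  qed
  have wi: "integrable lborel (\<lambda>t. indicator \<Omega> t * w t)"
  proof (rule Bochner_Integration.integrable_bound[OF integrable_mult_right[OF integrable_indicator_Omega, of 2]])
    show "AE t in lborel. norm (indicator \<Omega> t * w t) \<le> norm (2 * indicator \<Omega> t :: real)"
      using w_le2 w_pos by (auto simp: indicator_def)
  qed simp
  let ?L = "\<Omega> - {a + 3 * \<epsilon>..b - 3 * \<epsilon>}"
  have dual_le: "kap * (\<integral>t. indicator (W t) y * (indicator \<Omega> t * w t) \<partial>lborel) \<le> 1 + indicator ?L y"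
    if y: "y \<in> \<Omega>" for y
  proof -
    have b2: "\<bar>indicator \<Omega> t * w t\<bar> \<le> 2" for t using w_le2[of t] w_pos[of t] by (auto simp: indicator_def)
    show ?thesis
    proof (cases "y \<in> ?L")
      case True
      have "\<bar>kap * (\<integral>t. indicator (W t) y * (indicator \<Omega> t * w t) \<partial>lborel) - 1\<bar> \<le> 1"
        using w_le2 w_pos by (intro win_dual_close[OF _ b2]) (auto simp: indicator_def abs_le_iff)
      then show ?thesis using True by simp
    next
      case False
      \<comment> \<open>The layer width 3 \<epsilon> is the 2 \<epsilon> needed for w plus the
        distance from y to the centre t, which is at most \<open>len\<close> <= \<epsilon>.\<close>
      have "w t \<le> 1" if "y \<in> W t" "t \<in> \<Omega>" for t
        using dist_win[of t y] that False y eps by (intro w_le1) auto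
      then have "\<bar>indicator \<Omega> t * w t - 1 / 2\<bar> \<le> 1 / 2" if "y \<in> W t" for t
        using w_pos[of t] that unfolding abs_le_iff by (cases "t \<in> \<Omega>") auto
      then have "\<bar>kap * (\<integral>t. indicator (W t) y * (indicator \<Omega> t * w t) \<partial>lborel) - 1 / 2\<bar> \<le> 1 / 2"
        by (intro win_dual_close[OF _ b2]) auto
      then have "kap * (\<integral>t. indicator (W t) y * (indicator \<Omega> t * w t) \<partial>lborel) \<le> 1" by linarith
      then show ?thesis using False by simp
    qed
  qed
  have total: "(\<integral>x. indicator \<Omega> x * A x \<partial>lborel) \<le> V (\<Omega> - B) + V ?L"
  proof -
    \<comment> \<open>Fubini is used twice: \<open>FA\<close> trades the \<epsilon>-average for the
      weight w, and \<open>F\<close> trades the window average for the adjoint average of w,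
      integrated over Q.\<close>
    note F = win_Fubini[OF Q.sigma_finite_measure_axioms id wi vB]
    have "(\<integral>x. indicator \<Omega> x * A x \<partial>lborel) = (\<integral>t. kap * ((indicator \<Omega> t * w t) * (\<integral>y. indicator (W t) y * indicator (- B) y \<partial>Q)) \<partial>lborel)"
      unfolding FA(3) G_def by (intro Bochner_Integration.integral_cong) auto
    also have "\<dots> = (\<integral>y. kap * (indicator (- B) y * (\<integral>t. indicator (W t) y * (indicator \<Omega> t * w t) \<partial>lborel)) \<partial>Q)"
      unfolding integral_mult_right_zero F(3) ..
    also have "\<dots> \<le> (\<integral>y. indicator (\<Omega> - B) y + indicator ?L y \<partial>Q)"
    proof (rule integral_mono)
      show "integrable Q (\<lambda>y. kap * (indicator (- B) y * (\<integral>t. indicator (W t) y * (indicator \<Omega> t * w t) \<partial>lborel)))"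
        by (intro integrable_mult_right F(2))
      show "integrable Q (\<lambda>y. indicator (\<Omega> - B) y + indicator ?L y :: real)"
        by (intro Bochner_Integration.integrable_add integrable_real_indicator) (auto simp: setQ Q.emeasure_finite less_top[symmetric])
      fix y assume "y \<in> space Q"
      then show "kap * (indicator (- B) y * (\<integral>t. indicator (W t) y * (indicator \<Omega> t * w t) \<partial>lborel))
          \<le> indicator (\<Omega> - B) y + indicator ?L y"
        using dual_le[of y] by (cases "y \<in> B") (auto simp: spQ indicator_def)
    qed
    also have "\<dots> = measure Q (\<Omega> - B) + measure Q ?L"
      by (subst Bochner_Integration.integral_add)
        (auto simp: setQ Q.emeasure_finite less_top[symmetric] spQ Int_absorb2 intro!: integrable_real_indicator)
    also have "\<dots> = V (\<Omega> - B) + V ?L" by (subst (1 2) QV) auto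
    finally show ?thesis .
  qed
  \<comment> \<open>Outside S p no t within \<epsilon> of x has p in its window, because windows
    reach at most \<open>len\<close> from their centre.\<close>
  define S where "S p = {p - (\<epsilon> + len)<..<p + (\<epsilon> + len)}" for p :: real
  have avg_le: "avg_abs a b \<epsilon> g x \<le> A x" if x: "x \<in> \<Omega>" and xS: "\<And>p. p \<in> B \<Longrightarrow> x \<notin> S p" for x
  proof -
    let ?I = "{x - \<epsilon><..<x + \<epsilon>} \<inter> \<Omega>"
    have "(LINT t:?I|lborel. \<bar>g t\<bar>) \<le> (\<integral>t. indicator ?I t * (indicator \<Omega> t * G t) \<partial>lborel)"
      unfolding set_lebesgue_integral_def
    proof (rule integral_mono')
      show "integrable lborel (\<lambda>t. indicator ?I t * (indicator \<Omega> t * G t))"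
        using integrable_mult_indicator[OF _ Gi, of ?I] by simp
      fix t
      show "indicator ?I t *\<^sub>R \<bar>g t\<bar> \<le> indicator ?I t * (indicator \<Omega> t * G t)"
      proof (cases "t \<in> ?I")
        case True
        have "W t \<inter> B = {}"
        proof (rule ccontr)
          assume "W t \<inter> B \<noteq> {}"
          then obtain p where p: "p \<in> W t" "p \<in> B" by blast
          have "\<bar>t - p\<bar> \<le> len" using p True by (intro dist_win) auto
          then have "x \<in> S p" using True by (auto simp: S_def)
          then show False using xS p by blast
        qed
        then show ?thesis using gG[of t] True by simp
      qed simp
      show "0 \<le> indicator ?I t * (indicator \<Omega> t * G t)" using Gpos by simp
    qed
    moreover have "A x = (\<integral>t. indicator ?I t * (indicator \<Omega> t * G t) \<partial>lborel) / m x"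
      unfolding A_def integral_divide_zero[symmetric]
      by (intro Bochner_Integration.integral_cong) (auto simp: k_def indicator_def)
    ultimately show ?thesis
      unfolding avg_abs_def m_eq[OF x] using m_pos[of x] eps by (simp add: divide_right_mono)
  qed
  have Si: "integrable lborel (\<lambda>x. indicator (S p) x :: real)" "(\<integral>x. indicator (S p) x \<partial>lborel) = 2 * (\<epsilon> + len)" for p
    using eps len_pos by (auto simp: S_def)
  have "(LINT x:\<Omega>|lborel. f_cost c0 (\<epsilon> * avg_abs a b \<epsilon> g x))
      \<le> (\<integral>x. c0 * (\<Sum>p\<in>B. indicator (S p) x) + c0 * \<epsilon> * (indicator \<Omega> x * A x) \<partial>lborel)"
    unfolding set_lebesgue_integral_def
  proof (rule integral_mono')
    show "integrable lborel (\<lambda>x. c0 * (\<Sum>p\<in>B. indicator (S p) x) + c0 * \<epsilon> * (indicator \<Omega> x * A x))"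
      using Si(1) FA(1) by (intro Bochner_Integration.integrable_add integrable_mult_right Bochner_Integration.integrable_sum)
    fix x
    have S0: "0 \<le> c0 * (\<Sum>p\<in>B. indicator (S p) x)" using c0 by (intro mult_nonneg_nonneg sum_nonneg) auto
    have A0: "0 \<le> c0 * \<epsilon> * (indicator \<Omega> x * A x)" using c0 eps A_pos by simp
    show "0 \<le> c0 * (\<Sum>p\<in>B. indicator (S p) x) + c0 * \<epsilon> * (indicator \<Omega> x * A x)"
      using S0 A0 by simp
    show "indicator \<Omega> x *\<^sub>R f_cost c0 (\<epsilon> * avg_abs a b \<epsilon> g x)
        \<le> c0 * (\<Sum>p\<in>B. indicator (S p) x) + c0 * \<epsilon> * (indicator \<Omega> x * A x)"
    proof (cases "x \<in> \<Omega>")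
      case x: True
      show ?thesis
      proof (cases "\<exists>p\<in>B. x \<in> S p")
        case True
        then obtain p where p: "p \<in> B" "x \<in> S p" by blast
        have "indicator (S p) x \<le> (\<Sum>p\<in>B. indicator (S p) x :: real)"
          using B p by (intro member_le_sum) auto
        then have "c0 * 1 \<le> c0 * (\<Sum>p\<in>B. indicator (S p) x)"
          using p c0 by (intro mult_left_mono) auto
        moreover have "f_cost c0 (\<epsilon> * avg_abs a b \<epsilon> g x) \<le> c0 * 1"
          unfolding f_cost_def using c0 by (intro mult_left_mono) auto
        ultimately show ?thesis using A0 x by simp
      next
        case False
        have "f_cost c0 (\<epsilon> * avg_abs a b \<epsilon> g x) \<le> c0 * (\<epsilon> * avg_abs a b \<epsilon> g x)"
          unfolding f_cost_def using c0 by (intro mult_left_mono) auto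
        also have "\<dots> \<le> c0 * (\<epsilon> * A x)"
          using avg_le[OF x] False c0 eps by (intro mult_left_mono) auto
        finally show ?thesis using S0 x by simp
      qed
    qed (use S0 in simp)
  qed
  also have "\<dots> = c0 * (card B * (2 * (\<epsilon> + len))) + c0 * \<epsilon> * (\<integral>x. indicator \<Omega> x * A x \<partial>lborel)"
    using Si FA(1) by (subst Bochner_Integration.integral_add) (auto simp: Bochner_Integration.integral_sum)
  also have "\<dots> \<le> c0 * (card B * (2 * (\<epsilon> + len))) + c0 * \<epsilon> * (V (\<Omega> - B) + V ?L)"
    using total c0 eps by (intro add_left_mono mult_left_mono) auto
  finally show ?thesis .
qed

end

section \<open>The limit energy\<close>

text \<open>The real-valued supremum bounds its elements only once the set is bounded above; the
  total mass of any representing pair P, N provides this.\<close>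

lemma total_variation_ge:
  assumes C: "signed_measure a b C"
    and A: "A \<in> sets borel" "A \<subseteq> {a<..<b}" "A' \<in> sets borel" "A' \<subseteq> {a<..<b}" "A \<inter> A' = {}"
  shows "\<bar>C A\<bar> + \<bar>C A'\<bar> \<le> total_variation a b C"
proof -
  obtain P N where rep: "sm_rep a b C P N" using C by (auto simp: signed_measure_def)
  note r = sm_repD[OF rep]
  interpret P: finite_measure P by (fact r)
  interpret N: finite_measure N by (fact r)
  let ?S = "{(\<Sum>A\<in>\<P>. \<bar>C A\<bar>) | \<P>. finite \<P> \<and> disjoint \<P> \<and> (\<forall>A\<in>\<P>. A \<in> sets borel \<and> A \<subseteq> {a<..<b})}"
  have bdd: "bdd_above ?S"
  proof (rule bdd_aboveI)
    fix s assume "s \<in> ?S"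
    then obtain \<P> where \<P>: "s = (\<Sum>A\<in>\<P>. \<bar>C A\<bar>)" "finite \<P>" "disjoint \<P>"
      "\<And>A. A \<in> \<P> \<Longrightarrow> A \<in> sets borel \<and> A \<subseteq> {a<..<b}" by auto
    have dj: "disjoint_family_on (\<lambda>A. A) \<P>" using \<P>(3) by (auto simp: disjoint_family_on_def disjoint_def)
    have sets: "(\<lambda>A. A) ` \<P> \<subseteq> sets P" "(\<lambda>A. A) ` \<P> \<subseteq> sets N" using \<P>(4) r(1,2) by (auto simp: sets_restrict_Ioo_iff)
    have "\<bar>C A\<bar> \<le> measure P A + measure N A" if "A \<in> \<P>" for A
      using \<P>(4)[OF that] r(8)[of A] measure_nonneg[of P A] measure_nonneg[of N A] by linarith
    then have "s \<le> (\<Sum>A\<in>\<P>. measure P A + measure N A)"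
      unfolding \<P>(1) by (rule sum_mono)
    also have "\<dots> = measure P (\<Union>A\<in>\<P>. A) + measure N (\<Union>A\<in>\<P>. A)"
      using P.finite_measure_finite_Union[OF \<P>(2) sets(1) dj] N.finite_measure_finite_Union[OF \<P>(2) sets(2) dj]
      by (simp add: sum.distrib)
    also have "\<dots> \<le> measure P (space P) + measure N (space N)"
      by (intro add_mono P.bounded_measure N.bounded_measure)
    finally show "s \<le> measure P (space P) + measure N (space N)" .
  qed
  have "\<bar>C A\<bar> + \<bar>C A'\<bar> = (\<Sum>X\<in>{A, A'}. \<bar>C X\<bar>)"
  proof (cases "A = A'")
    \<comment> \<open>If A = A' the set {A, A'} has one element and its sum would count it once.
      Disjointness makes A empty, so both sides vanish.\<close>
    case True
    then have "A = {}" using A by auto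
    then show ?thesis using True r(8)[of "{}"] by simp
  qed simp
  also have "\<dots> \<le> total_variation a b C"
    unfolding total_variation_def
    by (rule cSup_upper[OF _ bdd]) (use A in \<open>auto intro!: exI[of _ "{A, A'}"] simp: disjoint_def\<close>)
  finally show ?thesis .
qed

lemma ac_measure_diff_le:
  assumes g: "set_integrable lborel {a<..<b} g"
    and A: "A \<in> sets borel" "A \<subseteq> {a<..<b}" "A' \<in> sets borel" "A' \<subseteq> {a<..<b}" "A \<inter> A' = {}"
  shows "ac_measure g A - ac_measure g A' \<le> (LINT x:{a<..<b}|lborel. \<bar>g x\<bar>)"
proof -
  have i: "set_integrable lborel A g" "set_integrable lborel A' g"
    using A by (auto intro: set_integrable_subset[OF g])
  have "ac_measure g A - ac_measure g A' = (\<integral>x. indicator A x *\<^sub>R g x - indicator A' x *\<^sub>R g x \<partial>lborel)"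
    using i unfolding ac_measure_def set_lebesgue_integral_def set_integrable_def by simp
  also have "\<dots> \<le> (\<integral>x. indicator {a<..<b} x *\<^sub>R \<bar>g x\<bar> \<partial>lborel)"
  proof (rule integral_mono')
    show "integrable lborel (\<lambda>x. indicator {a<..<b} x *\<^sub>R \<bar>g x\<bar>)"
      using set_integrable_abs[OF g] by (simp add: set_integrable_def)
    show "indicator A x *\<^sub>R g x - indicator A' x *\<^sub>R g x \<le> indicator {a<..<b} x *\<^sub>R \<bar>g x\<bar>" for x
      using A by (auto simp: indicator_def)
  qed auto
  finally show ?thesis by (simp add: set_lebesgue_integral_def)
qed

lemma jump_measure_diff_le:
  assumes s: "jmp summable_on J" and A: "A \<inter> A' = {}" "A \<inter> B = {}" "A' \<inter> B = {}"
  shows "jump_measure J jmp A - jump_measure J jmp A' \<le> infsum (\<lambda>x. \<bar>jmp x\<bar>) (J - B)"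
proof -
  have sa: "(\<lambda>x. \<bar>jmp x\<bar>) summable_on J"
    using s summable_on_iff_abs_summable_on_real[of jmp J] by simp
  have sub: "jmp summable_on J \<inter> X" "(\<lambda>x. \<bar>jmp x\<bar>) summable_on J \<inter> X" for X
    using summable_on_subset_banach[OF s] summable_on_subset_banach[OF sa] by auto
  have "jump_measure J jmp A \<le> infsum (\<lambda>x. \<bar>jmp x\<bar>) (J \<inter> A)"
    unfolding jump_measure_def by (intro infsum_mono sub) auto
  moreover
  have "(\<lambda>x. - jmp x) summable_on J \<inter> A'" using sub(1)[of A'] by (simp add: summable_on_uminus)
  then have "- jump_measure J jmp A' \<le> infsum (\<lambda>x. \<bar>jmp x\<bar>) (J \<inter> A')"
    unfolding jump_measure_def infsum_uminus[symmetric] by (intro infsum_mono sub) auto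
  moreover have "infsum (\<lambda>x. \<bar>jmp x\<bar>) (J \<inter> A) + infsum (\<lambda>x. \<bar>jmp x\<bar>) (J \<inter> A')
      = infsum (\<lambda>x. \<bar>jmp x\<bar>) (J \<inter> A \<union> J \<inter> A')"
    using A by (intro infsum_Un_disjoint[symmetric] sub) auto
  moreover have "\<dots> \<le> infsum (\<lambda>x. \<bar>jmp x\<bar>) (J - B)"
    using A by (intro infsum_mono2 summable_on_subset_banach[OF sa]) auto
  ultimately show ?thesis by linarith
qed

text \<open>The cost \<open>2 f(s / 2)\<close> of a jump of height \<open>s\<close> is \<open>c0 s\<close> up to \<open>s = 2\<close> and \<open>2 c0\<close> beyond.\<close>

lemma finite_large_jumps:
  fixes jmp :: "real \<Rightarrow> real"
  assumes s: "jmp summable_on J"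
  shows "finite {x \<in> J. 2 < \<bar>jmp x\<bar>}"
proof -
  have sa: "(\<lambda>x. \<bar>jmp x\<bar>) summable_on J"
    using s summable_on_iff_abs_summable_on_real[of jmp J] by simp
  have "card G \<le> nat \<lceil>infsum (\<lambda>x. \<bar>jmp x\<bar>) J\<rceil>" if G: "G \<subseteq> {x \<in> J. 2 < \<bar>jmp x\<bar>}" "finite G" for G
  proof -
    have "real (card G) = (\<Sum>x\<in>G. 1)" by simp
    also have "\<dots> \<le> (\<Sum>x\<in>G. \<bar>jmp x\<bar>)" using G by (intro sum_mono) force
    also have "\<dots> \<le> infsum (\<lambda>x. \<bar>jmp x\<bar>) J" using G by (intro finite_sum_le_infsum sa) auto
    finally show ?thesis by linarith
  qed
  then show ?thesis using finite_if_finite_subsets_card_bdd by blast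
qed

lemma infsum_jump_cost:
  fixes jmp :: "real \<Rightarrow> real"
  assumes s: "jmp summable_on J" and c0: "0 < c0"
  defines "B \<equiv> {x \<in> J. 2 < \<bar>jmp x\<bar>}"
  shows "2 * infsum (\<lambda>x. f_cost c0 (\<bar>jmp x\<bar> / 2)) J
    = 2 * c0 * card B + c0 * infsum (\<lambda>x. \<bar>jmp x\<bar>) (J - B)"
proof -
  have fin: "finite B" unfolding B_def by (rule finite_large_jumps[OF s])
  have sa: "(\<lambda>x. \<bar>jmp x\<bar>) summable_on J"
    using s summable_on_iff_abs_summable_on_real[of jmp J] by simp
  let ?f = "\<lambda>x. f_cost c0 (\<bar>jmp x\<bar> / 2)"
  have eq: "?f x = c0 / 2 * \<bar>jmp x\<bar>" if "x \<in> J - B" for x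
    using that by (auto simp: B_def f_cost_def min_def)
  have sJB: "(\<lambda>x. c0 / 2 * \<bar>jmp x\<bar>) summable_on (J - B)"
    by (intro summable_on_cmult_right summable_on_subset_banach[OF sa]) auto
  then have sf: "?f summable_on (J - B)"
    using summable_on_cong[of "J - B" ?f, OF eq] by simp
  have "infsum ?f J = infsum ?f (B \<union> (J - B))"
    by (rule arg_cong[where f = "infsum ?f"]) (auto simp: B_def)
  also have "\<dots> = infsum ?f B + infsum ?f (J - B)"
    using fin sf by (intro infsum_Un_disjoint) auto
  also have "infsum ?f B = (\<Sum>x\<in>B. c0)"
    unfolding infsum_finite[OF fin] by (intro sum.cong) (auto simp: B_def f_cost_def)
  also have "infsum ?f (J - B) = infsum (\<lambda>x. c0 / 2 * \<bar>jmp x\<bar>) (J - B)"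
    by (intro infsum_cong eq)
  also have "\<dots> = c0 / 2 * infsum (\<lambda>x. \<bar>jmp x\<bar>) (J - B)" by (rule infsum_cmult_right')
  finally show ?thesis by simp
qed

text \<open>The end points do not belong to the interval, so each of its points eventually leaves
  the layer. An arbitrary null sequence need not give nested layers, hence dominated convergence
  instead of continuity from above.\<close>

lemma measure_boundary_layer_tendsto_0:
  fixes a b :: real
  assumes P: "finite_measure P" "sets P = sets (restrict_space borel {a<..<b})"
  shows "((\<lambda>\<epsilon>. measure P ({a<..<b} - {a + 3 * \<epsilon>..b - 3 * \<epsilon>})) \<longlongrightarrow> 0) (at_right 0)"
  unfolding tendsto_at_iff_sequentially
proof (intro allI impI)
  fix X :: "nat \<Rightarrow> real" assume X: "\<forall>i. X i \<in> {0<..} - {0}" "X \<longlonglongrightarrow> 0"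
  interpret finite_measure P by fact
  let ?L = "\<lambda>n. {a<..<b} - {a + 3 * X n..b - 3 * X n}"
  have sp: "space P = {a<..<b}" using sets_eq_imp_space_eq[OF P(2)] by (simp add: space_restrict_space)
  have L: "?L n \<in> sets P" for n using P(2) by (simp add: sets_restrict_Ioo_iff)
  have "(\<lambda>n. \<integral>y. indicator (?L n) y \<partial>P) \<longlonglongrightarrow> (\<integral>y. (0 :: real) \<partial>P)"
  proof (rule integral_dominated_convergence)
    show "integrable P (\<lambda>_. 1 :: real)" by simp
    show "(\<lambda>y. indicator (?L n) y :: real) \<in> borel_measurable P" for n using L by simp
    show "AE y in P. (\<lambda>n. indicator (?L n) y :: real) \<longlonglongrightarrow> 0"
    proof (rule AE_I2)
      fix y assume "y \<in> space P"
      then have y: "a < y" "y < b" by (auto simp: sp)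
      have "(\<lambda>n. a + 3 * X n) \<longlonglongrightarrow> a + 3 * 0" "(\<lambda>n. b - 3 * X n) \<longlonglongrightarrow> b - 3 * 0"
        by (intro tendsto_intros X)+
      then have "eventually (\<lambda>n. a + 3 * X n < y) sequentially" "eventually (\<lambda>n. y < b - 3 * X n) sequentially"
        using y by (auto dest: order_tendstoD)
      then have "eventually (\<lambda>n. indicator (?L n) y = (0 :: real)) sequentially"
        by eventually_elim (auto simp: indicator_def)
      then show "(\<lambda>n. indicator (?L n) y :: real) \<longlonglongrightarrow> 0" by (rule tendsto_eventually)
    qed
  qed auto
  moreover have "?L n \<inter> space P = ?L n" for n using sp by auto
  ultimately show "((\<lambda>\<epsilon>. measure P ({a<..<b} - {a + 3 * \<epsilon>..b - 3 * \<epsilon>})) \<circ> X) \<longlonglongrightarrow> 0"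
    by (simp add: comp_def)
qed

section \<open>The recovery sequence\<close>

text \<open>The energy of one fixed admissible decomposition is the bound here, as a real number;
  the infimum in \<open>E_lim\<close> is taken only afterwards.\<close>

lemma recovery_sequence:
  fixes a b c0 K :: real
  assumes ab: "a < b" and c0: "0 < c0"
    and dec: "BV_decomp a b u u' J jmp C"
    and K: "ess_bound a b K u"
    and \<gamma>: "signed_measure a b \<gamma>"
    and g: "set_integrable lborel {a<..<b} g"
    and \<gamma>_eq: "sm_eq a b \<gamma> (\<lambda>A. jump_measure J jmp A + C A + ac_measure g A)"
    and L2: "L2_on a b (\<lambda>x. u' x - g x)"
  shows "E_gamma_sup a b c0 K u \<gamma> \<le> ereal ((LINT x:{a<..<b}|lborel. (u' x - g x)\<^sup>2)
    + c0 * (LINT x:{a<..<b}|lborel. \<bar>g x\<bar>)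
    + 2 * infsum (\<lambda>x. f_cost c0 (\<bar>jmp x\<bar> / 2)) J + c0 * total_variation a b C)"
proof -
  let ?\<Omega> = "{a<..<b}"
  define \<mu> where "\<mu> = (\<lambda>A. ac_measure u' A + jump_measure J jmp A + C A)"
  have u': "set_integrable lborel ?\<Omega> u'" and s: "jmp summable_on J" and C: "signed_measure a b C"
    and BV: "BV_deriv a b u \<mu>"
    using dec by (auto simp: BV_decomp_def cantor_type_def \<mu>_def)
  have u: "set_integrable lborel ?\<Omega> u" using BV by (simp add: BV_deriv_def)
  define h where "h x = u' x - g x" for x
  have hm: "h \<in> borel_measurable borel" and h2: "set_integrable lborel ?\<Omega> (\<lambda>x. (h x)\<^sup>2)"
    using L2 by (simp_all add: L2_on_def h_def[abs_def])
  have h: "set_integrable lborel ?\<Omega> h" unfolding h_def[abs_def] using u' g by (rule set_integral_diff)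
  \<comment> \<open>Jump and Cantor parts occur identically in Du and in \<gamma> and cancel, so
    that only the density h is left.\<close>
  have \<mu>_eq: "\<mu> A = \<gamma> A + (LINT x:A|lborel. h x)" if A: "A \<in> sets borel" "A \<subseteq> ?\<Omega>" for A
  proof -
    have "set_integrable lborel A u'" "set_integrable lborel A g"
      using A by (auto intro: set_integrable_subset[OF u'] set_integrable_subset[OF g])
    then have "(LINT x:A|lborel. h x) = ac_measure u' A - ac_measure g A"
      unfolding h_def ac_measure_def by (rule set_integral_diff)
    moreover have "\<gamma> A = jump_measure J jmp A + C A + ac_measure g A"
      using \<gamma>_eq A by (simp add: sm_eq_def)
    ultimately show ?thesis by (simp add: \<mu>_def)
  qed
  obtain P N Y where rep: "sm_rep a b \<gamma> P N" and Y: "Y \<in> sets borel" "Y \<subseteq> ?\<Omega>"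
    and jordan: "\<And>A. A \<in> sets borel \<Longrightarrow> A \<subseteq> ?\<Omega> \<Longrightarrow> measure P A + measure N A = \<gamma> (A \<inter> Y) - \<gamma> (A - Y)"
    using Jordan_decomposition[OF \<gamma>] by blast
  note r = sm_repD[OF rep]
  define V where "V A = measure P A + measure N A" for A
  define B where "B = {x \<in> J. 2 < \<bar>jmp x\<bar>}"
  have B: "finite B" unfolding B_def by (rule finite_large_jumps[OF s])
  have Bb [measurable]: "B \<in> sets borel" using B by (rule finite_imp_closed[THEN borel_closed])

  \<comment> \<open>The first entry makes the window length at most \<epsilon>^2. The cap 1/2 keeps
    the window admissible for every positive \<epsilon>, as competitors must be defined for all of
    them, and provides the uniform L^1 estimate.\<close>
  define \<theta> where "\<theta> \<epsilon> = min (\<epsilon>\<^sup>2 / (b - a)) (1 / 2)" for \<epsilon> :: real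
  have \<theta>: "0 < \<theta> \<epsilon>" "\<theta> \<epsilon> \<le> 1 / 2" if "0 < \<epsilon>" for \<epsilon>
    using that ab by (simp_all only: \<theta>_def min.cobounded2) simp
  have win: "window a b (\<theta> \<epsilon>)" if "0 < \<epsilon>" for \<epsilon>
    using ab \<theta>[OF that] by unfold_locales auto
  have len: "window.len a b (\<theta> \<epsilon>) \<le> \<epsilon>\<^sup>2" if "0 < \<epsilon>" for \<epsilon>
  proof -
    have "\<theta> \<epsilon> * (b - a) \<le> \<epsilon>\<^sup>2 / (b - a) * (b - a)" using ab by (intro mult_right_mono) (auto simp: \<theta>_def)
    then show ?thesis using ab by (simp add: window.len_def[OF win[OF that]])
  qed
  define G where "G \<epsilon> x = window.kap a b (\<theta> \<epsilon>) * \<gamma> (win a b (\<theta> \<epsilon>) x)" for \<epsilon> x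
  define H where "H \<epsilon> x = (1 - \<theta> \<epsilon>) * window.avg a b (\<theta> \<epsilon>) h x" for \<epsilon> x
  define U where "U \<epsilon> = window.avg a b (\<theta> \<epsilon>) u" for \<epsilon>
  \<comment> \<open>The factor 1 + \<epsilon> at the high jumps comes from \<open>len\<close> /
    \<epsilon> <= \<epsilon>; the last term is the doubly counted boundary layer.\<close>
  define R where "R \<epsilon> = (LINT x:?\<Omega>|lborel. (h x)\<^sup>2) + 2 * c0 * card B * (1 + \<epsilon>)
      + c0 * (V (?\<Omega> - B) + V (?\<Omega> - {a + 3 * \<epsilon>..b - 3 * \<epsilon>}))" for \<epsilon>
  have Gi: "set_integrable lborel ?\<Omega> (G \<epsilon>)" if e: "0 < \<epsilon>" for \<epsilon>
    using window.win_adjoint_integrable[OF win[OF e] rep, of "\<lambda>_. 1" 1] by (simp add: G_def[abs_def])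
  have wd: "weak_deriv a b (U \<epsilon>) (\<lambda>x. G \<epsilon> x + H \<epsilon> x)" if e: "0 < \<epsilon>" for \<epsilon>
    unfolding U_def
  proof (rule weak_deriv_cong[OF window.weak_deriv_avg[OF win[OF e] BV]])
    interpret window a b "\<theta> \<epsilon>" by (rule win[OF e])
    fix x assume "x \<in> ?\<Omega>"
    then have "\<mu> (W x) = \<gamma> (W x) + (LINT y:W x|lborel. h y)" by (intro \<mu>_eq win_borel win_subset)
    then show "kap * \<mu> (W x) = G \<epsilon> x + H \<epsilon> x"
      by (simp add: G_def H_def avg_def kap_def distrib_left)
  qed
  have energy: "E_eps a b c0 K \<epsilon> (U \<epsilon>) (ac_measure (G \<epsilon>)) \<le> ereal (R \<epsilon>)"
    if e: "0 < \<epsilon>" "\<epsilon> < b - a" "\<epsilon> < 1" for \<epsilon>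
  proof -
    interpret window a b "\<theta> \<epsilon>" by (rule win[OF e(1)])
    have le: "len \<le> \<epsilon>\<^sup>2" "\<epsilon>\<^sup>2 \<le> \<epsilon>" using len[OF e(1)] e by (auto simp: power2_eq_square mult_left_le)
    have Hm: "H \<epsilon> \<in> borel_measurable borel" "set_integrable lborel ?\<Omega> (\<lambda>x. (H \<epsilon> x)\<^sup>2)"
      using avg_measurable[OF hm] avg_L2_integrable[OF hm h h2] by (auto simp: H_def[abs_def])
    \<comment> \<open>Membership of this pair bounds the infimum in \<open>E_eps\<close> from above;
      its elastic part is H, which is square integrable by Jensen.\<close>
    have "(\<lambda>x. G \<epsilon> x + H \<epsilon> x, G \<epsilon>) \<in> {(u', g). weak_deriv a b (U \<epsilon>) u' \<and> ess_bound a b K (U \<epsilon>) \<and>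
        signed_measure a b (ac_measure (G \<epsilon>)) \<and> set_integrable lborel ?\<Omega> g \<and>
        sm_eq a b (ac_measure (G \<epsilon>)) (ac_measure g) \<and> L2_on a b (\<lambda>x. u' x - g x)}"
      using wd[OF e(1)] ess_bound_avg[OF u K] Gi[OF e(1)] signed_measure_ac_measure[OF Gi[OF e(1)]] Hm
      by (simp add: U_def sm_eq_def L2_on_def)
    then have "E_eps a b c0 K \<epsilon> (U \<epsilon>) (ac_measure (G \<epsilon>)) \<le>
      ereal ((LINT x:?\<Omega>|lborel. (H \<epsilon> x)\<^sup>2) + (1 / \<epsilon>) * (LINT x:?\<Omega>|lborel. f_cost c0 (\<epsilon> * avg_abs a b \<epsilon> (G \<epsilon>) x)))"
      unfolding E_eps_def by (rule INF_lower2) simp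
    also have "\<dots> \<le> ereal (R \<epsilon>)"
    proof -
      have 1: "(LINT x:?\<Omega>|lborel. (H \<epsilon> x)\<^sup>2) \<le> (LINT x:?\<Omega>|lborel. (h x)\<^sup>2)"
        using avg_L2_le[OF hm h h2] by (simp add: H_def)
      have "(1 / \<epsilon>) * (LINT x:?\<Omega>|lborel. f_cost c0 (\<epsilon> * avg_abs a b \<epsilon> (G \<epsilon>) x))
        \<le> (1 / \<epsilon>) * (c0 * (card B * (2 * (\<epsilon> + len))) + c0 * \<epsilon> * (V (?\<Omega> - B) + V (?\<Omega> - {a + 3 * \<epsilon>..b - 3 * \<epsilon>})))"
        using e le unfolding V_def
        by (intro mult_left_mono nonlocal_energy_le[OF rep _ B c0]) (auto simp: G_def)
      also have "\<dots> = 2 * c0 * card B * (1 + len / \<epsilon>) + c0 * (V (?\<Omega> - B) + V (?\<Omega> - {a + 3 * \<epsilon>..b - 3 * \<epsilon>}))"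
        using e by (simp add: field_simps)
      also have "\<dots> \<le> 2 * c0 * card B * (1 + \<epsilon>) + c0 * (V (?\<Omega> - B) + V (?\<Omega> - {a + 3 * \<epsilon>..b - 3 * \<epsilon>}))"
        using e le c0 by (intro add_right_mono mult_left_mono add_left_mono) (auto simp: field_simps power2_eq_square)
      finally show ?thesis using 1 by (simp add: R_def)
    qed
    finally show ?thesis .
  qed
  have Vlim: "((\<lambda>\<epsilon>. V (?\<Omega> - {a + 3 * \<epsilon>..b - 3 * \<epsilon>})) \<longlongrightarrow> 0 + 0) (at_right 0)"
    unfolding V_def using r by (intro tendsto_add measure_boundary_layer_tendsto_0) auto
  have Rlim: "(R \<longlongrightarrow> (LINT x:?\<Omega>|lborel. (h x)\<^sup>2) + 2 * c0 * card B * (1 + 0) + c0 * (V (?\<Omega> - B) + (0 + 0))) (at_right 0)"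
    unfolding R_def[abs_def] by (intro tendsto_intros Vlim)
  let ?R = "(LINT x:?\<Omega>|lborel. (h x)\<^sup>2) + 2 * c0 * card B + c0 * V (?\<Omega> - B)"
  have small: "eventually (\<lambda>\<epsilon>. 0 < \<epsilon> \<and> \<epsilon> < b - a \<and> \<epsilon> < 1) (at_right (0 :: real))"
    unfolding eventually_at_right_field using ab by (intro exI[of _ "min (b - a) 1"]) auto
  have limsup: "Limsup (at_right 0) (\<lambda>\<epsilon>. E_eps a b c0 K \<epsilon> (U \<epsilon>) (ac_measure (G \<epsilon>))) \<le> ereal ?R"
  proof -
    have "Limsup (at_right 0) (\<lambda>\<epsilon>. E_eps a b c0 K \<epsilon> (U \<epsilon>) (ac_measure (G \<epsilon>))) \<le> Limsup (at_right 0) (\<lambda>\<epsilon>. ereal (R \<epsilon>))"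
      by (rule Limsup_mono) (use small in \<open>eventually_elim, auto intro: energy\<close>)
    also have "\<dots> = ereal ?R"
      using Rlim by (intro lim_imp_Limsup) auto
    finally show ?thesis .
  qed

  have "(U, \<lambda>\<epsilon>. ac_measure (G \<epsilon>)) \<in> {(U, \<Gamma>). (\<forall>\<epsilon>>0. set_integrable lborel ?\<Omega> (U \<epsilon>) \<and> signed_measure a b (\<Gamma> \<epsilon>)) \<and>
      ((\<lambda>\<epsilon>. LINT x:?\<Omega>|lborel. \<bar>U \<epsilon> x - u x\<bar>) \<longlongrightarrow> 0) (at_right 0) \<and>
      ((\<lambda>\<epsilon>. flat_norm a b (\<lambda>A. \<Gamma> \<epsilon> A - \<gamma> A)) \<longlongrightarrow> 0) (at_right 0)}"
  proof (safe)
    fix \<epsilon> :: real assume e: "0 < \<epsilon>"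
    show "set_integrable lborel ?\<Omega> (U \<epsilon>)" unfolding U_def by (rule window.set_integrable_avg[OF win[OF e] u])
    show "signed_measure a b (ac_measure (G \<epsilon>))" by (rule signed_measure_ac_measure[OF Gi[OF e]])
  next
    show "((\<lambda>\<epsilon>. LINT x:?\<Omega>|lborel. \<bar>U \<epsilon> x - u x\<bar>) \<longlongrightarrow> 0) (at_right 0)"
      unfolding tendsto_at_iff_sequentially comp_def U_def
    proof (intro allI impI)
      fix X :: "nat \<Rightarrow> real" assume X: "\<forall>i. X i \<in> {0<..} - {0}" "X \<longlonglongrightarrow> 0"
      have "(\<lambda>n. min ((X n)\<^sup>2 / (b - a)) (1 / 2)) \<longlonglongrightarrow> min (0\<^sup>2 / (b - a)) (1 / 2)"
        using ab by (intro tendsto_intros X) auto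
      then have "(\<lambda>n. \<theta> (X n)) \<longlonglongrightarrow> 0" by (simp add: \<theta>_def)
      then show "(\<lambda>n. LINT x:?\<Omega>|lborel. \<bar>window.avg a b (\<theta> (X n)) u x - u x\<bar>) \<longlonglongrightarrow> 0"
        using X \<theta> by (intro avg_tendsto_L1[OF ab u]) auto
    qed
  next
    show "((\<lambda>\<epsilon>. flat_norm a b (\<lambda>A. ac_measure (G \<epsilon>) A - \<gamma> A)) \<longlongrightarrow> 0) (at_right 0)"
    proof (rule Lim_null_comparison)
      show "eventually (\<lambda>\<epsilon>. norm (flat_norm a b (\<lambda>A. ac_measure (G \<epsilon>) A - \<gamma> A)) \<le> \<epsilon>\<^sup>2 * V ?\<Omega>) (at_right 0)"
        using small
      proof eventually_elim
        case (elim \<epsilon>)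
        then have e: "0 < \<epsilon>" by simp
        have "\<bar>flat_norm a b (\<lambda>A. ac_measure (G \<epsilon>) A - \<gamma> A)\<bar> \<le> window.len a b (\<theta> \<epsilon>) * V ?\<Omega>"
          unfolding V_def by (rule window.flat_norm_smoothed[OF win[OF e] rep]) (simp add: G_def)
        also have "\<dots> \<le> \<epsilon>\<^sup>2 * V ?\<Omega>" using len[OF e] by (intro mult_right_mono) (auto simp: V_def)
        finally show ?case by simp
      qed
      have "((\<lambda>\<epsilon>. \<epsilon>\<^sup>2 * V ?\<Omega>) \<longlongrightarrow> 0\<^sup>2 * V ?\<Omega>) (at_right 0)" by (intro tendsto_intros)
      then show "((\<lambda>\<epsilon>. \<epsilon>\<^sup>2 * V ?\<Omega>) \<longlongrightarrow> 0) (at_right 0)" by simp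
    qed
  qed
  then have "E_gamma_sup a b c0 K u \<gamma> \<le> Limsup (at_right 0) (\<lambda>\<epsilon>. E_eps a b c0 K \<epsilon> (U \<epsilon>) (ac_measure (G \<epsilon>)))"
    unfolding E_gamma_sup_def by (rule INF_lower2) simp
  also note limsup
  also have "ereal ?R \<le> ereal ((LINT x:?\<Omega>|lborel. (u' x - g x)\<^sup>2) + c0 * (LINT x:?\<Omega>|lborel. \<bar>g x\<bar>)
    + 2 * infsum (\<lambda>x. f_cost c0 (\<bar>jmp x\<bar> / 2)) J + c0 * total_variation a b C)"
  proof -
    \<comment> \<open>The Hahn set cuts the complement of the high jumps into two disjoint pieces.
      The variation is the difference of \<gamma> on them, and the jump, Cantor and absolutely
      continuous parts are each estimated on this same pair.\<close>
    let ?A = "(?\<Omega> - B) \<inter> Y" and ?A' = "(?\<Omega> - B) - Y"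
    have A: "?A \<in> sets borel" "?A \<subseteq> ?\<Omega>" "?A' \<in> sets borel" "?A' \<subseteq> ?\<Omega>" "?A \<inter> ?A' = {}" using Y by auto
    have "V (?\<Omega> - B) = \<gamma> ?A - \<gamma> ?A'" unfolding V_def by (rule jordan) auto
    also have "\<dots> = (jump_measure J jmp ?A - jump_measure J jmp ?A') + (C ?A - C ?A') + (ac_measure g ?A - ac_measure g ?A')"
      using \<gamma>_eq A by (simp add: sm_eq_def)
    also have "\<dots> \<le> infsum (\<lambda>x. \<bar>jmp x\<bar>) (J - B) + total_variation a b C + (LINT x:?\<Omega>|lborel. \<bar>g x\<bar>)"
      using total_variation_ge[OF C A]
      by (intro add_mono jump_measure_diff_le s ac_measure_diff_le[OF g A]) auto
    finally have "c0 * V (?\<Omega> - B) \<le> c0 * (infsum (\<lambda>x. \<bar>jmp x\<bar>) (J - B) + total_variation a b C + (LINT x:?\<Omega>|lborel. \<bar>g x\<bar>))"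
      using c0 by (intro mult_left_mono) auto
    then show ?thesis
      unfolding infsum_jump_cost[OF s c0, folded B_def] by (simp add: h_def distrib_left)
  qed
  finally show ?thesis .
qed

theorem mainTheorem14:
  fixes a b c0 K :: real and u u' g jmp :: "real \<Rightarrow> real" and J :: "real set"
    and C \<gamma> :: "real set \<Rightarrow> real"
  assumes "a < b" and "0 < c0" and "0 < K"
    and "BV_decomp a b u u' J jmp C"
    and "ess_bound a b K u"
    and "signed_measure a b \<gamma>"
    and "set_integrable lborel {a<..<b} g"
    and "sm_eq a b \<gamma> (\<lambda>A. jump_measure J jmp A + C A + ac_measure g A)"
    and "L2_on a b (\<lambda>x. u' x - g x)"
  shows "E_gamma_sup a b c0 K u \<gamma> \<le> E_lim a b c0 K u \<gamma>"
  \<comment> \<open>\<open>E_lim\<close> is an infimum, so the bound is established for every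
    admissible tuple and not just for the one named in the statement.\<close>
  unfolding E_lim_def
  by (rule INF_greatest) (auto intro!: recovery_sequence[OF assms(1,2)])

end
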